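(* Polynomial--time bounded--error unary PTMs can recognize uncountably many languages in $O(\log \log n)$ space.
   Context: A probabilistic Turing machine (PTM) has a read--only two--way input tape, on which the input $w$ is placed between a left end-marker and a right end-marker (the dollar sign \$), and a two--way read/write work tape; in each step it chooses among transitions according to probability distributions, whose transition probabilities may be arbitrary real numbers (including uncomputable ones). The space used is the maximum number of work-tape cells visited over all computation paths, and $n$ is the input length. A language $L$ is recognized with bounded error if there is $\epsilon<1/2$ such that every member of $L$ is accepted with probability at least $1-\epsilon$ and every non-member is accepted with probability at most $\epsilon$. A unary PTM is one whose input alphabet has a single symbol. *)

theory Defs
  imports "HOL-Probability.Probability" "HOL-Library.Landau_Symbols" "HOL-Library.Extended_Nat"
begin

datatype 'a input_symbol = Left_End | Letter 'a | Right_End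

datatype move = Move_Left | Stay | Move_Right

text \<open>Transition probabilities are arbitrary reals because the values of a \<open>pmf\<close> are.
  An outcome \<open>(q', g', d, e)\<close> of \<open>trans q s g\<close> is the new state, the work-tape symbol
  written, the move of the input head and the move of the work head.\<close>

record ('q, 'g, 'a) ptm =
  states :: "'q set"
  input_alphabet :: "'a set"
  work_alphabet :: "'g set"
  blank :: 'g
  start :: 'q
  accepting :: 'q
  rejecting :: 'q
  trans :: "'q \<Rightarrow> 'a input_symbol \<Rightarrow> 'g \<Rightarrow> ('q \<times> 'g \<times> move \<times> move) pmf"

definition input_symbols :: "('q, 'g, 'a) ptm \<Rightarrow> 'a input_symbol set" where
  "input_symbols M = {Left_End, Right_End} \<union> Letter ` input_alphabet M"

text \<open>The last condition keeps the input head between the two end-markers.\<close>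

definition is_ptm :: "('q, 'g, 'a) ptm \<Rightarrow> bool" where
  "is_ptm M \<longleftrightarrow>
     finite (states M) \<and> finite (input_alphabet M) \<and> finite (work_alphabet M) \<and>
     input_alphabet M \<noteq> {} \<and> blank M \<in> work_alphabet M \<and>
     start M \<in> states M \<and> accepting M \<in> states M \<and> rejecting M \<in> states M \<and>
     accepting M \<noteq> rejecting M \<and>
     (\<forall>q \<in> states M - {accepting M, rejecting M}.
      \<forall>s \<in> input_symbols M. \<forall>g \<in> work_alphabet M.
      \<forall>(q', g', d, e) \<in> set_pmf (trans M q s g).
        q' \<in> states M \<and> g' \<in> work_alphabet M \<and>
        (s = Left_End \<longrightarrow> d \<noteq> Move_Left) \<and> (s = Right_End \<longrightarrow> d \<noteq> Move_Right))"

text \<open>On input \<open>w\<close>, position 0 of the input tape holds the left end-marker and position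
  \<open>length w + 1\<close> the right one. The work tape is infinite in both directions.\<close>

record ('q, 'g) config =
  cstate :: 'q
  input_pos :: nat
  work_tape :: "int \<Rightarrow> 'g"
  work_pos :: int

definition input_at :: "'a list \<Rightarrow> nat \<Rightarrow> 'a input_symbol" where
  "input_at w i =
     (if i = 0 then Left_End else if i \<le> length w then Letter (w ! (i - 1)) else Right_End)"

fun move_input :: "move \<Rightarrow> nat \<Rightarrow> nat" where
  "move_input Move_Left i = i - 1"
| "move_input Stay i = i"
| "move_input Move_Right i = i + 1"

fun move_work :: "move \<Rightarrow> int \<Rightarrow> int" where
  "move_work Move_Left i = i - 1"
| "move_work Stay i = i"
| "move_work Move_Right i = i + 1"

definition initial_config :: "('q, 'g, 'a) ptm \<Rightarrow> ('q, 'g) config" where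
  "initial_config M =
     \<lparr>cstate = start M, input_pos = 0, work_tape = (\<lambda>_. blank M), work_pos = 0\<rparr>"

definition halted :: "('q, 'g, 'a) ptm \<Rightarrow> ('q, 'g) config \<Rightarrow> bool" where
  "halted M c \<longleftrightarrow> cstate c = accepting M \<or> cstate c = rejecting M"

definition apply_outcome ::
    "('q, 'g) config \<Rightarrow> 'q \<times> 'g \<times> move \<times> move \<Rightarrow> ('q, 'g) config" where
  "apply_outcome c = (\<lambda>(q', g', d, e).
     \<lparr>cstate = q', input_pos = move_input d (input_pos c),
      work_tape = (work_tape c)(work_pos c := g'),
      work_pos = move_work e (work_pos c)\<rparr>)"

text \<open>Halting configurations are made absorbing so that the computation can be described by
  its distribution after any number of steps.\<close>

definition step :: "('q, 'g, 'a) ptm \<Rightarrow> 'a list \<Rightarrow> ('q, 'g) config \<Rightarrow> ('q, 'g) config pmf" where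
  "step M w c =
     (if halted M c then return_pmf c
      else map_pmf (apply_outcome c)
             (trans M (cstate c) (input_at w (input_pos c)) (work_tape c (work_pos c))))"

fun config_after :: "('q, 'g, 'a) ptm \<Rightarrow> 'a list \<Rightarrow> nat \<Rightarrow> ('q, 'g) config pmf" where
  "config_after M w 0 = return_pmf (initial_config M)"
| "config_after M w (Suc t) = bind_pmf (config_after M w t) (step M w)"

text \<open>The probabilities below increase with \<open>t\<close>, so the supremum is their limit: the
  probability of ever reaching the accepting state.\<close>

definition accept_prob :: "('q, 'g, 'a) ptm \<Rightarrow> 'a list \<Rightarrow> real" where
  "accept_prob M w =
     (SUP t. measure_pmf.prob (config_after M w t) {c. cstate c = accepting M})"

definition recognizes_bounded_error :: "('q, 'g, 'a) ptm \<Rightarrow> 'a list set \<Rightarrow> bool" where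
  "recognizes_bounded_error M L \<longleftrightarrow>
     L \<subseteq> lists (input_alphabet M) \<and>
     (\<exists>\<epsilon><1/2. \<forall>w \<in> lists (input_alphabet M).
        (w \<in> L \<longrightarrow> accept_prob M w \<ge> 1 - \<epsilon>) \<and>
        (w \<notin> L \<longrightarrow> accept_prob M w \<le> \<epsilon>))"

text \<open>Finite computation paths, given by the sequence of configurations they visit; a path
  is never continued beyond a halting configuration. Finite prefixes of infinite
  computations are included, so the suprema below also account for these.\<close>

definition computation_path ::
    "('q, 'g, 'a) ptm \<Rightarrow> 'a list \<Rightarrow> ('q, 'g) config list \<Rightarrow> bool" where
  "computation_path M w cs \<longleftrightarrow>
     cs \<noteq> [] \<and> hd cs = initial_config M \<and>
     (\<forall>i. Suc i < length cs \<longrightarrow>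
        \<not> halted M (cs ! i) \<and> cs ! Suc i \<in> set_pmf (step M w (cs ! i)))"

definition time_used :: "('q, 'g, 'a) ptm \<Rightarrow> 'a list \<Rightarrow> enat" where
  "time_used M w = (SUP cs \<in> {cs. computation_path M w cs}. enat (length cs - 1))"

definition space_used :: "('q, 'g, 'a) ptm \<Rightarrow> 'a list \<Rightarrow> enat" where
  "space_used M w = (SUP cs \<in> {cs. computation_path M w cs}. enat (card (work_pos ` set cs)))"

definition polynomial_time :: "('q, 'g, 'a) ptm \<Rightarrow> bool" where
  "polynomial_time M \<longleftrightarrow>
     (\<exists>(t :: nat \<Rightarrow> nat) k. (\<lambda>n. real (t n)) \<in> O(\<lambda>n. real n ^ k) \<and>
        (\<forall>w \<in> lists (input_alphabet M). time_used M w \<le> enat (t (length w))))"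

definition space_in_O :: "('q, 'g, 'a) ptm \<Rightarrow> (nat \<Rightarrow> real) \<Rightarrow> bool" where
  "space_in_O M f \<longleftrightarrow>
     (\<exists>s :: nat \<Rightarrow> nat. (\<lambda>n. real (s n)) \<in> O(f) \<and>
        (\<forall>w \<in> lists (input_alphabet M). space_used M w \<le> enat (s (length w))))"

end

theory Submission
  imports Defs "HOL-Real_Asymp.Real_Asymp"
begin

text \<open>
  Let \<open>F\<close> be the least non-divisor of \<open>n + 1\<close>. Since \<open>lcm(1, \<dots>, m)\<close> grows exponentially in \<open>m\<close>,
  \<open>F = O(log n)\<close>, so the machine can find \<open>F\<close> by trying \<open>i = 1, 2, \<dots>\<close> in turn: it walks
  along the input with a counter modulo \<open>i\<close>, in \<open>O(log log n)\<close> space. The number \<open>k\<close> of work-tape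
  cells in use at the end (the level of \<open>n\<close>) is unbounded in \<open>n\<close>, and \<open>64\<^sup>k = O(n)\<close>.

  For a set \<open>A\<close> of levels let \<open>p\<close> be the real number whose octal digits are 5 at the positions
  in \<open>A\<close> and 1 elsewhere. The machine tosses a coin of bias \<open>p\<close> exactly \<open>64\<^sup>k\<close> times, timed by
  a \<open>k\<close>-digit counter in base 64, and counts heads with \<open>k\<close> digits in base 8. By
  Hoeffding's inequality the number of heads divided by \<open>8\<^sup>k\<close> is within 1 of \<open>8\<^sup>k p\<close> with
  probability at least \<open>3/5\<close>, so the overflow of the second counter modulo 8 tells the \<open>k\<close>-th
  digit of \<open>p\<close>, that is, whether the level of \<open>n\<close> lies in \<open>A\<close>.
\<close>

section \<open>Runs of a probabilistic Turing machine\<close>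

text \<open>\<open>config_after\<close> appends steps at the end; peeling them off at the front,
  from any configuration, lets runs be composed.\<close>

primrec run :: "('q, 'g, 'a) ptm \<Rightarrow> 'a list \<Rightarrow> nat \<Rightarrow> ('q, 'g) config \<Rightarrow> ('q, 'g) config pmf" where
  "run M w 0 c = return_pmf c"
| "run M w (Suc t) c = bind_pmf (step M w c) (run M w t)"

lemma run_0': "run M w 0 = return_pmf"
  by (simp add: fun_eq_iff)

lemma run_add: "run M w (s + t) c = bind_pmf (run M w s c) (run M w t)"
  by (induction s arbitrary: c) (auto simp: bind_return_pmf bind_assoc_pmf intro!: bind_pmf_cong)

lemma config_after_eq_run: "config_after M w t = run M w t (initial_config M)"
proof (induction t)
  case (Suc t)
  have "run M w (Suc 0) = step M w"
    by (simp add: run_0' bind_return_pmf' fun_eq_iff del: run.simps(1))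
  then show ?case
    using run_add[of M w t "Suc 0" "initial_config M"] Suc by simp
qed simp

text \<open>Space is measured along whole paths, so the distribution after \<open>t\<close> steps is
  paired with an invariant of every configuration met on the way.\<close>

definition evolves ::
    "('q, 'g, 'a) ptm \<Rightarrow> 'a list \<Rightarrow> (('q, 'g) config \<Rightarrow> bool) \<Rightarrow> nat \<Rightarrow> ('q, 'g) config \<Rightarrow>
     ('q, 'g) config pmf \<Rightarrow> bool" where
  "evolves M w P t c D \<longleftrightarrow> run M w t c = D \<and> (\<forall>s\<le>t. \<forall>c' \<in> set_pmf (run M w s c). P c')"

abbreviation reaches ::
    "('q, 'g, 'a) ptm \<Rightarrow> 'a list \<Rightarrow> (('q, 'g) config \<Rightarrow> bool) \<Rightarrow> nat \<Rightarrow> ('q, 'g) config \<Rightarrow>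
     ('q, 'g) config \<Rightarrow> bool" where
  "reaches M w P t c c' \<equiv> evolves M w P t c (return_pmf c')"

lemma evolves_trans:
  assumes "evolves M w P s c D"
    and "\<And>c'. c' \<in> set_pmf D \<Longrightarrow> evolves M w P t c' (E c')"
  shows "evolves M w P (s + t) c (bind_pmf D E)"
  unfolding evolves_def
proof (intro conjI allI impI ballI)
  show "run M w (s + t) c = bind_pmf D E"
    using assms by (auto simp: evolves_def run_add intro!: bind_pmf_cong)
next
  fix s' c' assume s': "s' \<le> s + t" and c': "c' \<in> set_pmf (run M w s' c)"
  show "P c'"
  proof (cases "s' \<le> s")
    case True
    with c' assms(1) show ?thesis by (auto simp: evolves_def)
  next
    case False
    then have "run M w s' c = bind_pmf (run M w s c) (run M w (s' - s))"
      by (simp flip: run_add)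
    then obtain c'' where "c'' \<in> set_pmf D" "c' \<in> set_pmf (run M w (s' - s) c'')"
      using c' assms(1) by (auto simp: evolves_def)
    moreover have "s' - s \<le> t" using s' by simp
    ultimately show ?thesis using assms(2)[of c''] by (auto simp: evolves_def)
  qed
qed

text \<open>Indexing continuations by \<open>b\<close> rather than by \<open>f b\<close> spares
  \<open>f\<close> from being injective: the tossing configurations show the number of heads only
  modulo a power of 8.\<close>

lemma evolves_bind:
  assumes "evolves M v P s c (map_pmf f B)"
    and "\<And>b. b \<in> set_pmf B \<Longrightarrow> evolves M v P t (f b) (E b)"
  shows "evolves M v P (s + t) c (bind_pmf B E)"
proof -
  have "evolves M v P (s + t) c (bind_pmf (map_pmf f B) (run M v t))"
    using assms by (intro evolves_trans) (auto simp: evolves_def)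
  moreover have "bind_pmf (map_pmf f B) (run M v t) = bind_pmf B E"
    using assms(2) by (auto simp: bind_map_pmf evolves_def intro!: bind_pmf_cong)
  ultimately show ?thesis by simp
qed

lemma evolves_refl: "P c \<Longrightarrow> reaches M w P 0 c c"
  by (simp add: evolves_def)

lemma reaches_evolves:
  "reaches M w P s c c' \<Longrightarrow> evolves M w P t c' D \<Longrightarrow> evolves M w P (s + t) c D"
  using evolves_trans[of M w P s c "return_pmf c'" t "\<lambda>_. D"] by (simp add: bind_return_pmf)

lemma evolves_1:
  assumes "P c" "step M w c = D" "\<And>c'. c' \<in> set_pmf D \<Longrightarrow> P c'"
  shows "evolves M w P 1 c D"
  using assms by (auto simp: evolves_def run_0' bind_return_pmf' le_Suc_eq simp del: run.simps(1))

lemma reaches_step: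
  assumes "P c" "step M w c = return_pmf c'" "evolves M w P t c' D"
  shows "evolves M w P (Suc t) c D"
proof -
  have "P c'" using assms(3) by (force simp: evolves_def)
  then show ?thesis
    using reaches_evolves[OF evolves_1[of P c M w "return_pmf c'"] assms(3)] assms by simp
qed

section \<open>Time, space and acceptance from the distribution of runs\<close>

lemma computation_path_run:
  assumes "computation_path M w cs" "i < length cs"
  shows "cs ! i \<in> set_pmf (config_after M w i)"
  using assms(2)
proof (induction i)
  case 0
  then show ?case using assms(1) by (cases cs) (auto simp: computation_path_def)
next
  case (Suc i)
  then show ?case using assms(1) by (auto simp: computation_path_def)
qed

text \<open>A longer path would continue from its entry at index \<open>t\<close>, but this lies in
  the support at time \<open>t\<close> and is halted.\<close>

lemma computation_path_length:
  assumes "computation_path M w cs" "\<forall>c \<in> set_pmf (config_after M w t). halted M c"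
  shows "length cs \<le> Suc t"
proof (rule ccontr)
  assume "\<not> length cs \<le> Suc t"
  then have "Suc t < length cs" by simp
  moreover from this have "halted M (cs ! t)"
    using computation_path_run[OF assms(1), of t] assms(2) by simp
  ultimately show False using assms(1) by (auto simp: computation_path_def)
qed

lemma time_used_le:
  assumes "\<forall>c \<in> set_pmf (config_after M w t). halted M c"
  shows "time_used M w \<le> enat t"
  unfolding time_used_def
  by (rule SUP_least) (use computation_path_length[OF _ assms] in fastforce)

lemma space_used_le:
  assumes "evolves M w (\<lambda>c. work_pos c \<in> S) t (initial_config M) D"
    and "\<forall>c \<in> set_pmf D. halted M c" "finite S"
  shows "space_used M w \<le> enat (card S)"
  unfolding space_used_def
proof (rule SUP_least)
  have D: "config_after M w t = D" using assms(1) by (simp add: evolves_def config_after_eq_run)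
  fix cs assume "cs \<in> {cs. computation_path M w cs}"
  then have cs: "computation_path M w cs" by simp
  have "work_pos ` set cs \<subseteq> S"
  proof (safe)
    fix c assume "c \<in> set cs"
    then obtain i where i: "i < length cs" "c = cs ! i" by (auto simp: in_set_conv_nth)
    then have "i \<le> t" using computation_path_length[OF cs, of t] assms(2) D by simp
    with computation_path_run[OF cs i(1)] assms(1) i show "work_pos c \<in> S"
      by (auto simp: evolves_def config_after_eq_run)
  qed
  then show "enat (card (work_pos ` set cs)) \<le> enat (card S)"
    using assms(3) by (simp add: card_mono)
qed

lemma accept_prob_mono:
  "measure_pmf.prob (config_after M w t) {c. cstate c = accepting M}
     \<le> measure_pmf.prob (config_after M w (Suc t)) {c. cstate c = accepting M}"
proof -
  let ?A = "{c. cstate c = accepting M}"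
  have "emeasure (config_after M w t) ?A = (\<integral>\<^sup>+ c. indicator ?A c \<partial>config_after M w t)"
    by simp
  also have "\<dots> \<le> (\<integral>\<^sup>+ c. emeasure (step M w c) ?A \<partial>config_after M w t)"
    by (intro nn_integral_mono)
      (auto simp: step_def halted_def indicator_def measure_pmf.emeasure_eq_measure)
  also have "\<dots> = emeasure (config_after M w (Suc t)) ?A"
    by simp
  finally show ?thesis by (simp add: measure_pmf.emeasure_eq_measure)
qed

lemma config_after_halted:
  assumes "\<forall>c \<in> set_pmf (config_after M w t). halted M c" "t \<le> s"
  shows "config_after M w s = config_after M w t"
  using assms(2)
proof (induction s rule: dec_induct)
  case (step s)
  have "config_after M w (Suc s) = bind_pmf (config_after M w t) return_pmf"
    unfolding config_after.simps step.IH
    by (intro bind_pmf_cong) (use assms(1) in \<open>auto simp: step_def\<close>)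
  then show ?case by (simp add: bind_return_pmf')
qed simp

text \<open>Once all mass has halted the distribution is constant, so the supremum is attained at
  \<open>t\<close>.\<close>

lemma accept_prob_eq:
  assumes "\<forall>c \<in> set_pmf (config_after M w t). halted M c"
  shows "accept_prob M w = measure_pmf.prob (config_after M w t) {c. cstate c = accepting M}"
    (is "_ = ?f t")
proof -
  have mono: "?f s \<le> ?f s'" if "s \<le> s'" for s s'
    using that
    by (induction rule: dec_induct)
      (auto intro: order_trans accept_prob_mono simp del: config_after.simps)
  have "?f s \<le> ?f t" for s
    using mono[of s t] config_after_halted[OF assms, of s] by (cases "s \<le> t") auto
  then show ?thesis
    unfolding accept_prob_def
    by (intro antisym cSUP_least cSUP_upper bdd_aboveI2[where M = 1]) auto
qed

section \<open>Digits\<close>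

fun digits :: "nat \<Rightarrow> nat \<Rightarrow> nat \<Rightarrow> nat list" where
  "digits b 0 v = []"
| "digits b (Suc k) v = (v mod b) # digits b k (v div b)"

lemma length_digits [simp]: "length (digits b k v) = k"
  by (induction k arbitrary: v) auto

lemma digits_0 [simp]: "digits b k 0 = replicate k 0"
  by (induction k) auto

lemma digits_eq_iff:
  assumes "b > 0"
  shows "digits b k u = digits b k v \<longleftrightarrow> u mod b ^ k = v mod b ^ k"
proof (induction k arbitrary: u v)
  case (Suc k)
  have eq: "x mod b ^ Suc k = x mod b + b * (x div b mod b ^ k)" for x
    by (simp add: mod_mult2_eq mult.commute)
  have "x mod b + b * y = x' mod b + b * y' \<longleftrightarrow> x mod b = x' mod b \<and> y = y'" for x x' y y'
  proof
    assume *: "x mod b + b * y = x' mod b + b * y'"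
    then have "(x mod b + b * y) mod b = (x' mod b + b * y') mod b"
      "(x mod b + b * y) div b = (x' mod b + b * y') div b" by simp_all
    with assms show "x mod b = x' mod b \<and> y = y'" by simp
  qed simp
  then show ?case using Suc by (simp only: eq digits.simps list.inject)
qed simp

text \<open>The machine compares counters digit by digit, hence only modulo \<open>64 ^ k\<close>;
  as \<open>m mod i < i < 64 ^ k\<close>, no wrap-around can fake equality.\<close>

lemma digits_Suc_mod_eq:
  assumes "0 < i" "i < 64 ^ k"
  shows "digits 64 k (Suc (m mod i)) = digits 64 k i \<longleftrightarrow> Suc (m mod i) = i"
proof -
  have "Suc (m mod i) < 64 ^ k" using assms mod_less_divisor[of i m] by linarith
  with assms show ?thesis by (simp add: digits_eq_iff)
qed

lemma digits_snoc: "digits b (Suc k) v = digits b k v @ [v div b ^ k mod b]"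
  by (induction k arbitrary: v) (simp_all add: div_mult2_eq)

fun carry :: "nat \<Rightarrow> nat \<Rightarrow> nat \<Rightarrow> bool \<Rightarrow> bool" where
  "carry b 0 v c = c"
| "carry b (Suc k) v c = carry b k (v div b) (b \<le> v mod b + of_bool c)"

lemma add_of_bool_div:
  fixes v b :: nat
  assumes "b > 0"
  shows "(v + of_bool c) div b = v div b + of_bool (b \<le> v mod b + of_bool c)"
  using assms by (cases c) (auto simp: div_Suc mod_Suc not_le dest: mod_less_divisor[of b v])

text \<open>As \<open>v\<close> is not assumed to fit into \<open>k\<close> digits, this also tracks
  an overflow kept outside the tape, as for the head counter.\<close>

lemma carry_div:
  assumes "b > 0"
  shows "(v + of_bool c) div b ^ k = v div b ^ k + of_bool (carry b k v c)"
  by (induction k arbitrary: v c) (simp_all add: div_mult2_eq add_of_bool_div[OF assms])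

lemma carry_iff:
  assumes "v < b ^ k" "b > 0"
  shows "carry b k v c \<longleftrightarrow> c \<and> Suc v = b ^ k"
proof -
  have eq: "(v + of_bool c) div b ^ k = of_bool (carry b k v c)"
    using carry_div[of b v c k] assms by simp
  show ?thesis
  proof (cases "c \<and> Suc v = b ^ k")
    case True
    with eq assms show ?thesis by (cases "carry b k v c") auto
  next
    case False
    with assms(1) have "v + of_bool c < b ^ k" by (cases c) auto
    with eq False show ?thesis by (cases "carry b k v c") auto
  qed
qed

section \<open>The least non-divisor\<close>

text \<open>Nair's argument, through \<open>1/((m+1) C(n,m+1)) = 1/(m C(n-1,m)) - 1/(m C(n,m))\<close>.\<close>

lemma mult_choose_dvd:
  assumes "\<And>i. 1 \<le> i \<Longrightarrow> i \<le> n \<Longrightarrow> i dvd D" "1 \<le> m" "m \<le> n"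
  shows "m * (n choose m) dvd D"
  using assms(2,3,1)
proof (induction m arbitrary: n rule: dec_induct)
  case base
  then show ?case by simp
next
  case (step m)
  define n' where "n' = n - 1"
  have n: "n = Suc n'" "m \<le> n'" using step by (auto simp: n'_def)
  obtain m' where m: "m = Suc m'" using step by (cases m) auto
  define x where "x = int (n' choose m)"
  define y where "y = int (n' choose m')"
  have pos: "x > 0" "y > 0" using n m by (auto simp: x_def y_def)
  have c: "int (n choose m) = x + y" by (simp add: n m x_def y_def)
  have c': "int (Suc m * (n choose Suc m)) = int n * x"
    using arg_cong[OF Suc_times_binomial_eq[of n' m], of int]
    by (simp only: n x_def of_nat_mult mult.commute)
  have b: "int m * (x + y) = int n * y"
    using arg_cong[OF Suc_times_binomial_eq[of n' m'], of int]
    by (simp only: flip: c) (simp only: n m y_def of_nat_mult mult.commute)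
  have "m * (n' choose m) dvd D" using step.IH[of n'] step.prems n by auto
  then obtain s where "D = m * (n' choose m) * s" by (elim dvdE)
  then have s: "int D = int m * x * int s" by (simp add: x_def)
  have "m * (n choose m) dvd D" using step.IH[of n] step.prems n by auto
  then obtain t where "D = m * (n choose m) * t" by (elim dvdE)
  then have t: "int D = int m * (x + y) * int t" by (simp flip: c)
  \<comment> \<open>This is the identity above multiplied by \<open>D\<close>: \<open>s\<close> and
    \<open>t\<close> are the quotients of \<open>D\<close> by the denominators on its right-hand
    side. The spare factor \<open>y\<close> is cancelled afterwards.\<close>
  have "y * int D = int n * x * (int s - int t) * y"
  proof -
    have "int n * y * x * (int s - int t) = int m * (x + y) * x * (int s - int t)" by (simp add: b)
    also have "\<dots> = (x + y) * int D - x * int D" by (subst (1) s, subst t) (simp add: algebra_simps)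
    finally show ?thesis by (simp add: algebra_simps)
  qed
  then have "int D = int n * x * (int s - int t)" using pos by simp
  then have "int (Suc m * (n choose Suc m)) dvd int D" unfolding c' by simp
  then show ?case by (simp only: of_nat_dvd_iff)
qed

definition least_nondivisor :: "nat \<Rightarrow> nat" where
  "least_nondivisor N = (LEAST i. i > 0 \<and> \<not> i dvd N)"

lemma least_nondivisor:
  assumes "N > 0"
  shows "least_nondivisor N > 0" "\<not> least_nondivisor N dvd N"
    "\<And>i. 0 < i \<Longrightarrow> i < least_nondivisor N \<Longrightarrow> i dvd N" "least_nondivisor N \<le> Suc N"
proof -
  have *: "Suc N > 0 \<and> \<not> Suc N dvd N" using assms by (auto dest: dvd_imp_le)
  show "least_nondivisor N > 0" "\<not> least_nondivisor N dvd N"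
    using LeastI[of "\<lambda>i. i > 0 \<and> \<not> i dvd N", OF *] by (auto simp: least_nondivisor_def)
  show "least_nondivisor N \<le> Suc N"
    unfolding least_nondivisor_def by (rule Least_le) (rule *)
  show "\<And>i. 0 < i \<Longrightarrow> i < least_nondivisor N \<Longrightarrow> i dvd N"
    unfolding least_nondivisor_def by (auto dest: not_less_Least)
qed

text \<open>All numbers up to \<open>2 * j\<close> lie below the least non-divisor and so divide
  \<open>N\<close>; hence \<open>j * (2 * j choose j)\<close> divides \<open>N\<close>, and the
  central binomial coefficient is at least \<open>4 ^ j / (2 * j)\<close>.\<close>

lemma least_nondivisor_bound:
  assumes "N > 0"
  shows "2 ^ least_nondivisor N \<le> 8 * N"
proof -
  define j where "j = (least_nondivisor N - 1) div 2"
  have "4 ^ j \<le> 2 * N"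
  proof (cases "j = 0")
    case False
    have "j * (2 * j choose j) dvd N"
      using False by (intro mult_choose_dvd least_nondivisor(3)[OF assms]) (auto simp: j_def)
    then have "j * (2 * j choose j) \<le> N" using assms by (rule dvd_imp_le)
    then have "real j * real (2 * j choose j) \<le> real N" by (simp flip: of_nat_mult)
    moreover have "4 ^ j \<le> 2 * (real j * real (2 * j choose j))"
      using central_binomial_lower_bound[of j] False by (simp add: field_simps)
    ultimately have "real (4 ^ j) \<le> real (2 * N)" by simp
    then show ?thesis by (simp only: of_nat_le_iff)
  qed (use assms in simp)
  moreover have "(2::nat) ^ least_nondivisor N \<le> 2 ^ (2 * j + 2)"
    by (rule power_increasing) (auto simp: j_def)
  moreover have "(2::nat) ^ (2 * j + 2) = 4 * 4 ^ j" by (simp add: power_add power_mult)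
  ultimately show ?thesis by linarith
qed

section \<open>Number of digits and the level of an input length\<close>

text \<open>The recursion mirrors the machine: the counter gains a cell exactly when advancing it
  reaches the power of 64 that no longer fits. The value 0 takes no cell.\<close>

primrec num_digits :: "nat \<Rightarrow> nat" where
  "num_digits 0 = 0"
| "num_digits (Suc i) = (if Suc i = 64 ^ num_digits i then Suc (num_digits i) else num_digits i)"

lemma less_num_digits: "i < 64 ^ num_digits i"
  by (induction i) auto

lemma num_digits_le: "i > 0 \<Longrightarrow> 64 ^ num_digits i \<le> 64 * i"
proof (induction i)
  case (Suc i)
  then show ?case by (cases i) auto
qed simp

lemma num_digits_mono: "i \<le> j \<Longrightarrow> num_digits i \<le> num_digits j"
  by (induction rule: dec_induct) auto

lemma num_digits_le_self: "num_digits i \<le> i"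
  by (induction i) auto

text \<open>The inner \<open>Suc\<close> is the count \<open>n + 1\<close>; the outer one is there
  because the sweep that detects the non-divisor still advances it, possibly into a new
  cell.\<close>

definition level :: "nat \<Rightarrow> nat" where
  "level n = num_digits (Suc (least_nondivisor (Suc n)))"

lemma level_pos: "level n > 0"
  using num_digits_mono[of "Suc 0" "Suc (least_nondivisor (Suc n))"] by (simp add: level_def)

lemma infinite_range_level: "infinite (range level)"
  unfolding infinite_nat_iff_unbounded
proof
  fix m :: nat
  \<comment> \<open>Every positive number up to \<open>64 ^ m\<close> divides this factorial, which
    pushes its least non-divisor past \<open>64 ^ m\<close>.\<close>
  let ?N = "fact (64 ^ m) :: nat"
  have "Suc (?N - 1) = ?N" by simp
  then have "64 ^ m < least_nondivisor (Suc (?N - 1))"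
    using least_nondivisor(1,2)[of ?N] dvd_fact[of "least_nondivisor ?N" "64 ^ m"] by force
  also have "\<dots> < 64 ^ level (?N - 1)"
    unfolding level_def using less_num_digits[of "Suc (least_nondivisor (Suc (?N - 1)))"] by linarith
  finally have "m < level (?N - 1)" by (simp add: power_less_imp_less_exp)
  then show "\<exists>n>m. n \<in> range level" by blast
qed

text \<open>Only the crude bound \<open>n + 2\<close> on the least non-divisor enters; it makes the
  number of coin tosses linear in \<open>n\<close>.\<close>

lemma level_power_le: "64 ^ level n \<le> 64 * (n + 3)"
  using num_digits_le[of "Suc (least_nondivisor (Suc n))"] least_nondivisor(4)[of "Suc n"]
  unfolding level_def by simp

lemma level_bigo: "(\<lambda>n. real (level n + 2)) \<in> O(\<lambda>n. ln (ln (real n)))"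
proof -
  have "level n + 2 \<le> 3 + log 64 (log 2 (8 * (real n + 1)) + 1)" for n
  proof -
    define F where "F = least_nondivisor (Suc n)"
    have "2 ^ F \<le> 8 * Suc n" unfolding F_def by (rule least_nondivisor_bound) simp
    then have "real (2 ^ F) \<le> real (8 * Suc n)" by (simp only: of_nat_le_iff)
    then have F: "real F \<le> log 2 (8 * (real n + 1))"
      by (intro le_log_of_power) (simp_all add: algebra_simps)
    have "64 ^ level n \<le> 64 * Suc F"
      unfolding level_def F_def by (rule num_digits_le) simp
    then have "real (64 ^ level n) \<le> real (64 * Suc F)" by (simp only: of_nat_le_iff)
    then have "level n \<le> log 64 (64 * (real F + 1))"
      by (intro le_log_of_power) (simp_all add: algebra_simps)
    also have "\<dots> = 1 + log 64 (real F + 1)" by (subst log_mult) auto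
    also have "\<dots> \<le> 1 + log 64 (log 2 (8 * (real n + 1)) + 1)" using F by simp
    finally show ?thesis by simp
  qed
  then have "(\<lambda>n. real (level n + 2)) \<in> O(\<lambda>n. 3 + log 64 (log 2 (8 * (real n + 1)) + 1))"
    by (intro bigoI[where c = 1] always_eventually allI) (smt (verit) of_nat_0_le_iff real_norm_def)
  also have "(\<lambda>n::nat. 3 + log 64 (log 2 (8 * (real n + 1)) + 1)) \<in> O(\<lambda>n. ln (ln (real n)))"
    unfolding log_def by real_asymp
  finally show ?thesis .
qed

section \<open>Reading off an octal digit of the bias\<close>

text \<open>The digits 1 and 5 stay on their side of 4 modulo 8 even after an error less than 1 is
  added to a value in \<open>[e, e + 1]\<close>.\<close>

lemma coin_bias:
  fixes A :: "nat set"
  obtains p :: real where "p \<in> {0..1}"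
    "\<And>k. \<exists>z::nat. of_nat (8 * z + (if k \<in> A then 5 else 1)) \<le> 8 ^ Suc k * p \<and>
        8 ^ Suc k * p \<le> of_nat (8 * z + (if k \<in> A then 5 else 1) + 1)"
proof
  define d where "d k = (if k \<in> A then 5 else 1 :: nat)" for k
  define f where "f j = real (d j) / 8 ^ Suc j" for j
  define p where "p = suminf f"
  have geo: "(\<lambda>j. 7 / (8 :: real) ^ Suc (j + n)) sums (1 / 8 ^ n)" for n
  proof -
    have "(\<lambda>j. 7 / 8 ^ Suc n * (1/8 :: real) ^ j) sums (7 / 8 ^ Suc n * (1 / (1 - 1/8)))"
      by (intro sums_mult geometric_sums) simp
    moreover have "(\<lambda>j. 7 / 8 ^ Suc n * (1/8 :: real) ^ j) = (\<lambda>j. 7 / 8 ^ Suc (j + n))"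
      by (simp add: fun_eq_iff power_add power_divide)
    moreover have "7 / 8 ^ Suc n * (1 / (1 - 1/8)) = 1 / (8 :: real) ^ n"
      by (simp add: field_simps)
    ultimately show ?thesis by simp
  qed
  have f: "0 \<le> f j" "f j \<le> 7 / 8 ^ Suc j" for j
    by (auto simp: f_def d_def divide_right_mono)
  have summable: "summable f"
    by (rule summable_comparison_test'[where g = "\<lambda>j. 7 / 8 ^ Suc j" and N = 0])
      (use geo[of 0] f in \<open>auto simp: sums_iff\<close>)
  have tail: "0 \<le> (\<Sum>j. f (j + n))" "(\<Sum>j. f (j + n)) \<le> 1 / 8 ^ n" for n
  proof -
    have s: "summable (\<lambda>j. f (j + n))" using summable by (simp add: summable_iff_shift)
    show "0 \<le> (\<Sum>j. f (j + n))" by (rule suminf_nonneg[OF s]) (rule f)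
    have "(\<Sum>j. f (j + n)) \<le> (\<Sum>j. 7 / (8 :: real) ^ Suc (j + n))"
      by (rule suminf_le[OF f(2) s]) (use geo[of n] in \<open>simp add: sums_iff\<close>)
    then show "(\<Sum>j. f (j + n)) \<le> 1 / 8 ^ n" using geo[of n] by (simp add: sums_iff)
  qed
  show "p \<in> {0..1}" using tail[of 0] by (simp add: p_def)
  fix k
  \<comment> \<open>\<open>z\<close> is the integer formed by the first \<open>k\<close> octal
    digits. After scaling by \<open>8 ^ Suc k\<close> they give \<open>8 * z\<close>, the next digit
    gives \<open>d k\<close>, and the tail lies between 0 and 1.\<close>
  define z where "z = (\<Sum>j<k. d j * 8 ^ (k - Suc j))"
  have "8 ^ Suc k * (\<Sum>j<k. f j) = (\<Sum>j<k. real (8 * (d j * 8 ^ (k - Suc j))))"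
    unfolding sum_distrib_left
  proof (rule sum.cong)
    fix j assume "j \<in> {..<k}"
    then have "(8::real) ^ Suc k = 8 * 8 ^ (k - Suc j) * 8 ^ Suc j"
      by (simp flip: power_add power_Suc)
    then show "8 ^ Suc k * f j = real (8 * (d j * 8 ^ (k - Suc j)))"
      by (simp add: f_def del: power_Suc)
  qed simp
  also have "\<dots> = real (8 * z)" unfolding z_def by (simp only: of_nat_sum sum_distrib_left)
  finally have z: "8 ^ Suc k * (\<Sum>j<k. f j) = real (8 * z)" .
  have "p = (\<Sum>j. f (j + Suc k)) + (\<Sum>j<Suc k. f j)"
    unfolding p_def by (rule suminf_split_initial_segment[OF summable])
  then have "8 ^ Suc k * p = 8 ^ Suc k * (\<Sum>j. f (j + Suc k)) + 8 ^ Suc k * (\<Sum>j<k. f j) + 8 ^ Suc k * f k"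
    by (simp only: sum.lessThan_Suc distrib_left add.assoc)
  then have "8 ^ Suc k * p = 8 ^ Suc k * (\<Sum>j. f (j + Suc k)) + real (8 * z) + real (d k)"
    by (simp only: z) (simp add: f_def)
  moreover have "0 \<le> 8 ^ Suc k * (\<Sum>j. f (j + Suc k))" using tail(1)[of "Suc k"] by simp
  moreover have "8 ^ Suc k * (\<Sum>j. f (j + Suc k)) \<le> 1"
    using mult_left_mono[OF tail(2)[of "Suc k"], of "8 ^ Suc k"] by simp
  ultimately have "real (8 * z + d k) \<le> 8 ^ Suc k * p \<and> 8 ^ Suc k * p \<le> real (8 * z + d k + 1)"
    by simp
  then show "\<exists>z::nat. real (8 * z + (if k \<in> A then 5 else 1)) \<le> 8 ^ Suc k * p \<and>
        8 ^ Suc k * p \<le> real (8 * z + (if k \<in> A then 5 else 1) + 1)"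
    unfolding d_def by (rule exI[of _ z])
qed

text \<open>\<open>binomial_pmf_Suc\<close> draws the new toss first whereas the machine draws it
  last; independent draws commute.\<close>

lemma bind_binomial_bernoulli:
  fixes p :: real
  assumes "p \<in> {0..1}"
  shows "bind_pmf (binomial_pmf m p) (\<lambda>h. map_pmf (\<lambda>b. f (h + of_bool b)) (bernoulli_pmf p)) =
    map_pmf f (binomial_pmf (Suc m) p)"
proof -
  have "map_pmf f (binomial_pmf (Suc m) p) =
      bind_pmf (bernoulli_pmf p) (\<lambda>b. bind_pmf (binomial_pmf m p) (\<lambda>h. return_pmf (f (h + of_bool b))))"
    unfolding binomial_pmf_Suc[OF assms] map_bind_pmf map_return_pmf
    by (intro bind_pmf_cong) (auto simp: add.commute)
  also have "\<dots> = bind_pmf (binomial_pmf m p) (\<lambda>h. map_pmf (\<lambda>b. f (h + of_bool b)) (bernoulli_pmf p))"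
    unfolding map_pmf_def by (rule bind_commute_pmf)
  finally show ?thesis ..
qed

lemma binomial_octal_digit:
  fixes p :: real and k z e :: nat
  assumes p: "p \<in> {0..1}" and z: "real (8 * z + e) \<le> 8 ^ k * p" "8 ^ k * p \<le> real (8 * z + e + 1)"
    and e: "e = 1 \<or> e = 5"
  defines "X \<equiv> {h. 4 \<le> h div 8 ^ k mod 8}"
  shows "e = 5 \<Longrightarrow> measure_pmf.prob (binomial_pmf (64 ^ k) p) X \<ge> 3/5"
    and "e = 1 \<Longrightarrow> measure_pmf.prob (binomial_pmf (64 ^ k) p) X \<le> 2/5"
proof -
  let ?B = "binomial_pmf (64 ^ k) p"
  let ?Y = "{h. \<bar>real h - real (64 ^ k) * p\<bar> \<ge> 8 ^ k}"
  interpret binomial_distribution "64 ^ k" p by unfold_locales (rule p)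
  \<comment> \<open>Hoeffding's inequality with deviation \<open>8 ^ k\<close>, the square root of
    the number of tosses, gives \<open>2 / exp 2\<close> for every \<open>k\<close>; then
    \<open>exp 2\<close> is at least \<open>1 + 2 + 2 = 5\<close>.\<close>
  have "measure_pmf.prob ?B ?Y \<le> 2 * exp (- 2 * (8 ^ k)\<^sup>2 / real (64 ^ k))"
    by (rule prob_abs_ge) auto
  also have "(8 ^ k)\<^sup>2 = (64 ^ k :: real)" by (simp add: power2_eq_square flip: power_mult_distrib)
  also have "2 * exp (- 2 * 64 ^ k / real (64 ^ k)) = 2 / exp (2 :: real)" by (simp add: exp_minus field_simps)
  also have "\<dots> \<le> 2/5" using exp_lower_Taylor_quadratic[of 2] by (intro divide_left_mono) auto
  finally have Y: "measure_pmf.prob ?B ?Y \<le> 2/5" .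
  \<comment> \<open>Outside \<open>?Y\<close> the quotient \<open>h div 8 ^ k\<close> differs from
    \<open>8 * z + e\<close> by at most 1: modulo 8 it is 0, 1 or 2 for \<open>e = 1\<close> and 4,
    5 or 6 for \<open>e = 5\<close>.\<close>
  have good: "(4 \<le> h div 8 ^ k mod 8) = (e = 5)" if "h \<notin> ?Y" for h
  proof -
    have sq: "(64::real) ^ k = 8 ^ k * 8 ^ k" by (simp flip: power_mult_distrib)
    have "\<bar>real h - 8 ^ k * (8 ^ k * p)\<bar> < 8 ^ k" using that by (simp add: sq mult.assoc)
    moreover have "8 ^ k * real (8 * z + e) \<le> 8 ^ k * (8 ^ k * p)"
      "8 ^ k * (8 ^ k * p) \<le> 8 ^ k * real (8 * z + e + 1)" using z by (auto intro: mult_left_mono)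
    ultimately have "8 ^ k * real (8 * z + e) < real h + 8 ^ k" "real h < 8 ^ k * real (8 * z + e + 1) + 8 ^ k"
      by linarith+
    then have "real (8 ^ k * (8 * z + e)) < real (h + 8 ^ k)" "real h < real (8 ^ k * (8 * z + e + 1) + 8 ^ k)"
      by (simp_all add: algebra_simps)
    then have "8 ^ k * (8 * z + e) < h + 8 ^ k" "h < 8 ^ k * (8 * z + e + 1) + 8 ^ k"
      by (simp_all only: of_nat_less_iff)
    then have "(8 * z + e - 1) * 8 ^ k \<le> h" "h < (8 * z + e + 2) * 8 ^ k" using e
      by (auto simp: algebra_simps)
    then have "8 * z + e - 1 \<le> h div 8 ^ k" "h div 8 ^ k < 8 * z + e + 2"
      by (simp_all add: less_eq_div_iff_mult_less_eq div_less_iff_less_mult)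
    with e have "(\<exists>r<3. h div 8 ^ k = 8 * z + (e - 1) + r)"
      by (intro exI[of _ "h div 8 ^ k - (8 * z + (e - 1))"]) auto
    then obtain r where "r < 3" "h div 8 ^ k mod 8 = (e - 1 + r) mod 8" by (metis add.assoc mod_mult_self4)
    with e show ?thesis by auto
  qed
  show "e = 5 \<Longrightarrow> measure_pmf.prob ?B X \<ge> 3/5"
  proof -
    assume "e = 5"
    with good have "- X \<subseteq> ?Y" by (auto simp: X_def)
    then have "measure_pmf.prob ?B (- X) \<le> 2/5"
      using Y measure_pmf.finite_measure_mono[of "- X" ?Y ?B] by simp
    then show ?thesis using measure_pmf.prob_compl[of X ?B] by (simp add: Compl_eq_Diff_UNIV)
  qed
  show "e = 1 \<Longrightarrow> measure_pmf.prob ?B X \<le> 2/5"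
  proof -
    assume "e = 1"
    with good have "X \<subseteq> ?Y" by (auto simp: X_def)
    then show ?thesis using Y measure_pmf.finite_measure_mono[of X ?Y ?B] by simp
  qed
qed

section \<open>The machine\<close>

text \<open>The \<open>move\<close> is the direction of the current trip over the input.
  \<open>Restart\<close> steps from the blank left of the counters onto their lowest digit. The flag
  of \<open>TossLeft\<close> tells the sweep that clears the counters from one that merely
  rewinds.\<close>

datatype control =
    CountRight move bool bool bool
  | CountLeft move bool
  | Restart move
  | TossLeft bool nat
  | Toss nat
  | TossRight nat bool bool
  | Accepted
  | Rejected

instance move :: countable
  by countable_datatype

instance control :: countable
  by countable_datatype

text \<open>A cell holds one digit of each of two counters, least significant digits first:
  during counting the trial divisor and the position modulo it, during tossing the number of
  tosses and of heads.\<close>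

type_synonym cell = "nat \<times> nat"

definition is_end :: "'a input_symbol \<Rightarrow> bool" where
  "is_end s \<longleftrightarrow> s = Left_End \<or> s = Right_End"

fun turn :: "'a input_symbol \<Rightarrow> move \<Rightarrow> move" where
  "turn Left_End d = Move_Right"
| "turn Right_End d = Move_Left"
| "turn (Letter _) d = d"

text \<open>The flags of the right sweeps are the two pending carries and, while counting, whether the
  advanced residue agrees so far with the trial divisor, in which case the left sweep resets it.
  Every sweep advances the residue, also the one at an end-marker that advances the divisor. Hence one
  trip over the input counts \<open>n + 1\<close> rather than \<open>n\<close>, which keeps the search finite on the empty
  input. The number in the tossing states is the overflow of the head counter.\<close>

fun delta :: "real \<Rightarrow> control \<Rightarrow> 'a input_symbol \<Rightarrow> cell option \<Rightarrow>
    (control \<times> cell option \<times> move \<times> move) pmf" where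
  "delta p (CountRight d cx cy eq) s (Some (x, y)) = return_pmf
     (CountRight d (64 \<le> x + of_bool cx) (64 \<le> y + of_bool cy) (eq \<and> (y + of_bool cy) mod 64 = x),
      Some ((x + of_bool cx) mod 64, (y + of_bool cy) mod 64), Stay, Move_Right)"
| "delta p (CountRight d cx cy eq) s None = return_pmf
     (if is_end s \<and> \<not> eq then TossLeft True 0 else CountLeft d eq,
      if cx then Some (of_bool eq, 0) else None, Stay, Move_Left)"
| "delta p (CountLeft d eq) s (Some (x, y)) = return_pmf
     (CountLeft d eq, Some (x, if eq then 0 else y), Stay, Move_Left)"
| "delta p (CountLeft d eq) s None = return_pmf (Restart (turn s d), None, turn s d, Stay)"
| "delta p (Restart d) s g = return_pmf (CountRight d (is_end s) True True, g, Stay, Move_Right)"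
| "delta p (TossLeft z u) s (Some c) = return_pmf
     (TossLeft z u, Some (if z then (0, 0) else c), Stay, Move_Left)"
| "delta p (TossLeft z u) s None = return_pmf (Toss u, None, Stay, Stay)"
| "delta p (Toss u) s g =
     map_pmf (\<lambda>h. (TossRight u True h, g, Stay, Move_Right)) (bernoulli_pmf p)"
| "delta p (TossRight u cx cy) s (Some (x, y)) = return_pmf
     (TossRight u (64 \<le> x + of_bool cx) (8 \<le> y + of_bool cy),
      Some ((x + of_bool cx) mod 64, (y + of_bool cy) mod 8), Stay, Move_Right)"
| "delta p (TossRight u cx cy) s None = return_pmf
     (let u' = (u + of_bool cy) mod 8
      in if cx then if 4 \<le> u' then Accepted else Rejected else TossLeft False u',
      None, Stay, Move_Left)"
| "delta p Accepted s g = return_pmf (Accepted, g, Stay, Stay)"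
| "delta p Rejected s g = return_pmf (Rejected, g, Stay, Stay)"

definition controls :: "control set" where
  "controls = {q. \<forall>u. (\<exists>z. q = TossLeft z u) \<or> q = Toss u \<or> (\<exists>b c. q = TossRight u b c) \<longrightarrow> u < 8}"

definition cells :: "cell option set" where
  "cells = insert None (Some ` ({..<64} \<times> {..<64}))"

text \<open>Controls and cells are coded by \<open>to_nat\<close> since the theorem asks for states
  and symbols in \<open>nat\<close>. The empty tape is the divisor 0 without digits, so the start
  state is that of a sweep at an end-marker.\<close>

definition machine :: "'a \<Rightarrow> real \<Rightarrow> (nat, nat, 'a) ptm" where
  "machine a p =
     \<lparr>states = to_nat ` controls, input_alphabet = {a}, work_alphabet = to_nat ` cells,
      blank = to_nat (None :: cell option), start = to_nat (CountRight Move_Right True True True),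
      accepting = to_nat Accepted, rejecting = to_nat Rejected,
      trans = (\<lambda>q s g. map_pmf (\<lambda>(q', g', d, e). (to_nat q', to_nat g', d, e))
        (delta p (from_nat q) s (from_nat g)))\<rparr>"

lemma finite_controls: "finite controls"
proof -
  have fin: "finite (UNIV :: move set)"
  proof -
    have "(UNIV :: move set) = {Move_Left, Stay, Move_Right}" using move.exhaust by auto
    then show ?thesis by (metis finite.emptyI finite_insert)
  qed
  have "controls \<subseteq> (\<lambda>(d, cx, cy, eq). CountRight d cx cy eq) ` UNIV \<union>
      (\<lambda>(d, eq). CountLeft d eq) ` UNIV \<union> range Restart \<union>
      (\<lambda>(z, u). TossLeft z u) ` (UNIV \<times> {..<8}) \<union> Toss ` {..<8} \<union>
      (\<lambda>(u, cx, cy). TossRight u cx cy) ` ({..<8} \<times> UNIV) \<union> {Accepted, Rejected}"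
  proof
    fix q assume "q \<in> controls"
    then show "q \<in> (\<lambda>(d, cx, cy, eq). CountRight d cx cy eq) ` UNIV \<union>
      (\<lambda>(d, eq). CountLeft d eq) ` UNIV \<union> range Restart \<union>
      (\<lambda>(z, u). TossLeft z u) ` (UNIV \<times> {..<8}) \<union> Toss ` {..<8} \<union>
      (\<lambda>(u, cx, cy). TossRight u cx cy) ` ({..<8} \<times> UNIV) \<union> {Accepted, Rejected}"
      by (cases q) (auto simp: controls_def image_iff)
  qed
  then show ?thesis
    by (rule finite_subset) (auto simp: fin finite_Prod_UNIV simp flip: UNIV_Times_UNIV)
qed

lemma delta_closed:
  assumes "q \<in> controls" "g \<in> cells" "(q', g', d, e) \<in> set_pmf (delta p q s g)"
    "q \<noteq> Accepted" "q \<noteq> Rejected"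
  shows "q' \<in> controls \<and> g' \<in> cells"
proof (cases g)
  case None
  with assms show ?thesis
    by (cases q) (auto simp: controls_def cells_def Let_def split: if_splits)
next
  case (Some c)
  obtain x y where "c = (x, y)" by force
  with Some assms show ?thesis
    by (cases q) (auto simp: controls_def cells_def Let_def split: if_splits)
qed

lemma machine_sel [simp]:
  "input_alphabet (machine a p) = {a}"
  "accepting (machine a p) = to_nat Accepted"
  "rejecting (machine a p) = to_nat Rejected"
  by (simp_all add: machine_def)

lemma is_ptm_machine: "is_ptm (machine a p)"
proof -
  \<comment> \<open>The input head moves only where \<open>CountLeft\<close> meets a blank, and
    \<open>turn\<close> points inwards at both end-markers.\<close>
  have moves: "(d \<noteq> Move_Left \<or> s \<noteq> Left_End) \<and> (d \<noteq> Move_Right \<or> s \<noteq> Right_End)"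
    if "(q', g', d, e) \<in> set_pmf (delta p q s g)" for q' g' d e q g and s :: "'a input_symbol"
    using that by (cases "(p, q, s, g)" rule: delta.cases) (auto split: if_splits)
  have "to_nat (None :: cell option) \<in> to_nat ` cells" "to_nat (CountRight Move_Right True True True) \<in> to_nat ` controls"
    "to_nat Accepted \<in> to_nat ` controls" "to_nat Rejected \<in> to_nat ` controls" "finite cells"
    by (auto simp: controls_def cells_def)
  moreover have "case z of (q', g', d, e) \<Rightarrow> q' \<in> to_nat ` controls \<and> g' \<in> to_nat ` cells \<and>
      (s = Left_End \<longrightarrow> d \<noteq> Move_Left) \<and> (s = Right_End \<longrightarrow> d \<noteq> Move_Right)"
    if q: "q \<in> to_nat ` controls - {to_nat Accepted, to_nat Rejected}" and g: "g \<in> to_nat ` cells"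
      and z: "z \<in> set_pmf (trans (machine a p) q s g)" for q g z s
  proof -
    obtain q0 g0 where *: "q = to_nat q0" "q0 \<in> controls" "q0 \<noteq> Accepted" "q0 \<noteq> Rejected"
      "g = to_nat g0" "g0 \<in> cells" using q g by auto
    with z obtain q' g' d e where z': "(q', g', d, e) \<in> set_pmf (delta p q0 s g0)"
      "z = (to_nat q', to_nat g', d, e)" by (auto simp: machine_def)
    show ?thesis using delta_closed[OF *(2,6) z'(1) *(3,4)] moves[OF z'(1)] z'(2) by auto
  qed
  ultimately show ?thesis
    by (simp add: is_ptm_def finite_controls) (simp add: machine_def finite_controls)
qed

section \<open>Configurations and single steps\<close>

text \<open>The written cells form one block starting at position 0; the blanks at its two ends tell
  the sweeps where to turn.\<close>

definition cell_at :: "cell list \<Rightarrow> int \<Rightarrow> cell option" where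
  "cell_at ws j = (if 0 \<le> j \<and> j < int (length ws) then Some (ws ! nat j) else None)"

definition conf :: "control \<Rightarrow> nat \<Rightarrow> int \<Rightarrow> cell list \<Rightarrow> (nat, nat) config" where
  "conf q i j ws = \<lparr>cstate = to_nat q, input_pos = i, work_tape = (\<lambda>j. to_nat (cell_at ws j)), work_pos = j\<rparr>"

lemma work_pos_conf [simp]: "work_pos (conf q i j ws) = j"
  by (simp add: conf_def)

lemma halted_conf: "halted (machine a p) (conf q i j ws) \<longleftrightarrow> q = Accepted \<or> q = Rejected"
  by (simp add: halted_def conf_def)

lemma initial_config_machine:
  "initial_config (machine a p) = conf (CountRight Move_Right True True True) 0 0 []"
  by (auto simp: initial_config_def machine_def conf_def cell_at_def fun_eq_iff)

lemma step_machine: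
  assumes "q \<noteq> Accepted" "q \<noteq> Rejected"
  shows "step (machine a p) w (conf q i j ws) =
    map_pmf (\<lambda>(q', g, d, e). \<lparr>cstate = to_nat q', input_pos = move_input d i,
        work_tape = (\<lambda>j. to_nat (cell_at ws j))(j := to_nat g), work_pos = move_work e j\<rparr>)
      (delta p q (input_at w i) (cell_at ws j))"
  using assms
  by (simp add: step_def halted_conf)
    (simp add: conf_def machine_def pmf.map_comp o_def apply_outcome_def case_prod_unfold)

lemma step_cell:
  assumes "delta p q (input_at w i) (Some c) = return_pmf (q', Some c', d, e)"
    and "q \<noteq> Accepted" "q \<noteq> Rejected" "j = int (length ls)"
  shows "step (machine a p) w (conf q i j (ls @ c # rs)) =
    return_pmf (conf q' (move_input d i) (move_work e j) (ls @ c' # rs))"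
proof -
  have "(\<lambda>j. to_nat (cell_at (ls @ c # rs) j))(j := to_nat (Some c')) =
      (\<lambda>j. to_nat (cell_at (ls @ c' # rs) j))"
    using assms(4) by (auto simp: fun_eq_iff cell_at_def nth_append nth_Cons')
  moreover have "cell_at (ls @ c # rs) j = Some c"
    using assms(4) by (simp add: cell_at_def)
  ultimately show ?thesis
    using assms by (simp add: step_machine) (simp add: conf_def)
qed

lemma step_blank:
  assumes "delta p q (input_at w i) None = return_pmf (q', None, d, e)"
    and "q \<noteq> Accepted" "q \<noteq> Rejected" "j = -1 \<or> j = int (length ws)"
  shows "step (machine a p) w (conf q i j ws) =
    return_pmf (conf q' (move_input d i) (move_work e j) ws)"
proof -
  have *: "cell_at ws j = None" using assms(4) by (auto simp: cell_at_def)
  then have "(\<lambda>j. to_nat (cell_at ws j))(j := to_nat (None :: cell option)) =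
      (\<lambda>j. to_nat (cell_at ws j))"
    by (auto simp: fun_eq_iff)
  with * show ?thesis
    using assms by (simp add: step_machine) (simp add: conf_def)
qed

lemma step_extend:
  assumes "delta p q (input_at w i) None = return_pmf (q', Some c, d, e)"
    and "q \<noteq> Accepted" "q \<noteq> Rejected" "j = int (length ws)"
  shows "step (machine a p) w (conf q i j ws) =
    return_pmf (conf q' (move_input d i) (move_work e j) (ws @ [c]))"
proof -
  have *: "cell_at ws j = None" using assms(4) by (auto simp: cell_at_def)
  have "(\<lambda>j. to_nat (cell_at ws j))(j := to_nat (Some c)) =
      (\<lambda>j. to_nat (cell_at (ws @ [c]) j))"
    using assms(4) by (auto simp: fun_eq_iff cell_at_def nth_append)
  with * show ?thesis
    using assms by (simp add: step_machine) (simp add: conf_def)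
qed

text \<open>The only random step: its outcome enters the following sweep as the carry into the head
  counter.\<close>

lemma step_toss:
  "step (machine a p) w (conf (Toss u) i (-1) ws) =
    map_pmf (\<lambda>h. conf (TossRight u True h) i 0 ws) (bernoulli_pmf p)"
proof -
  have *: "cell_at ws (-1) = None" by (auto simp: cell_at_def)
  then have "(\<lambda>j. to_nat (cell_at ws j))(-1 := to_nat (None :: cell option)) =
      (\<lambda>j. to_nat (cell_at ws j))"
    by (auto simp: fun_eq_iff)
  with * show ?thesis
    by (simp add: step_machine pmf.map_comp o_def) (simp add: conf_def)
qed

lemma map_zip_first: "length xs = length ys \<Longrightarrow>
  map (\<lambda>(x, y). (x, 0)) (zip xs ys) = zip xs (replicate (length xs) 0)"
  by (induction xs ys rule: list_induct2) auto

section \<open>Sweeps over the work tape\<close>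

text \<open>The invariant of \<open>evo\<close> allows a block of \<open>K\<close> cells and the
  blanks at \<open>-1\<close> and \<open>K\<close> beside it.\<close>

locale bounded_run =
  fixes a :: 'a and p :: real and w :: "'a list" and K :: nat
begin

abbreviation "evo \<equiv> evolves (machine a p) w (\<lambda>c. work_pos c \<in> {-1..int K})"
abbreviation "goes t c c' \<equiv> evo t c (return_pmf c')"

text \<open>The advanced residue is compared with the old divisor, since at an end-marker the same
  sweep already advances the divisor. The passed cells \<open>ls\<close> and arbitrary flags are
  there for the induction.\<close>

lemma count_right:
  assumes "length ls + k \<le> K"
  shows "goes k (conf (CountRight d cx cy eq) i (int (length ls)) (ls @ zip (digits 64 k x) (digits 64 k y)))
    (conf (CountRight d (carry 64 k x cx) (carry 64 k y cy)
        (eq \<and> digits 64 k (y + of_bool cy) = digits 64 k x)) i (int (length ls + k))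
      (ls @ zip (digits 64 k (x + of_bool cx)) (digits 64 k (y + of_bool cy))))"
  using assms
proof (induction k arbitrary: ls x y cx cy eq)
  case 0
  then show ?case by (simp add: evolves_refl)
next
  case (Suc k)
  define cx' cy' eq' c where "cx' \<longleftrightarrow> 64 \<le> x mod 64 + of_bool cx" and "cy' \<longleftrightarrow> 64 \<le> y mod 64 + of_bool cy"
    and "eq' \<longleftrightarrow> eq \<and> (y mod 64 + of_bool cy) mod 64 = x mod 64"
    and "c = ((x mod 64 + of_bool cx) mod 64, (y mod 64 + of_bool cy) mod 64)"
  note defs = this
  let ?zs = "zip (digits 64 k (x div 64)) (digits 64 k (y div 64))"
  have 1: "step (machine a p) w (conf (CountRight d cx cy eq) i (int (length ls)) (ls @ (x mod 64, y mod 64) # ?zs)) =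
      return_pmf (conf (CountRight d cx' cy' eq') (move_input Stay i) (move_work Move_Right (int (length ls)))
        (ls @ c # ?zs))"
    unfolding defs by (rule step_cell) auto
  have "goes (Suc k) (conf (CountRight d cx cy eq) i (int (length ls)) (ls @ (x mod 64, y mod 64) # ?zs))
     (conf (CountRight d (carry 64 k (x div 64) cx') (carry 64 k (y div 64) cy')
        (eq' \<and> digits 64 k (y div 64 + of_bool cy') = digits 64 k (x div 64))) i (int (length ls + Suc k))
      (ls @ c # zip (digits 64 k (x div 64 + of_bool cx')) (digits 64 k (y div 64 + of_bool cy'))))"
    using Suc.IH[of "ls @ [c]" cx' cy' eq' "x div 64" "y div 64"] Suc.prems
    by (intro reaches_step[OF _ 1]) (simp_all add: add.commute)
  then show ?case
    by (simp only: add_of_bool_div mod_add_left_eq digits.simps(2) carry.simps zip_Cons_Cons list.inject conj_assoc defs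
        zero_less_numeral)
qed

lemma sweep_left:
  assumes "length ls + length rs \<le> K" "q \<noteq> Accepted" "q \<noteq> Rejected"
    and "\<And>c. delta p q (input_at w i) (Some c) = return_pmf (q, Some (f c), Stay, Move_Left)"
  shows "goes (length ls) (conf q i (int (length ls) - 1) (ls @ rs)) (conf q i (-1) (map f ls @ rs))"
  using assms(1)
proof (induction ls arbitrary: rs rule: rev_induct)
  case Nil
  then show ?case by (simp add: evolves_refl)
next
  case (snoc c ls)
  have "step (machine a p) w (conf q i (int (length ls)) (ls @ c # rs)) =
      return_pmf (conf q (move_input Stay i) (move_work Move_Left (int (length ls))) (ls @ f c # rs))"
    by (rule step_cell) (use assms in auto)
  from reaches_step[OF _ this] snoc.IH[of "f c # rs"] snoc.prems
  show ?case by simp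
qed

text \<open>The same \<open>k\<close> cells count to \<open>64 ^ k\<close> on one track and to its
  square root \<open>8 ^ k\<close> on the other, matching the number of tosses with the deviation of
  the heads.\<close>

lemma toss_right:
  assumes "length ls + k \<le> K"
  shows "goes k (conf (TossRight u cx cy) i (int (length ls)) (ls @ zip (digits 64 k x) (digits 8 k y)))
    (conf (TossRight u (carry 64 k x cx) (carry 8 k y cy)) i (int (length ls + k))
      (ls @ zip (digits 64 k (x + of_bool cx)) (digits 8 k (y + of_bool cy))))"
  using assms
proof (induction k arbitrary: ls x y cx cy)
  case 0
  then show ?case by (simp add: evolves_refl)
next
  case (Suc k)
  define cx' cy' c where "cx' \<longleftrightarrow> 64 \<le> x mod 64 + of_bool cx" and "cy' \<longleftrightarrow> 8 \<le> y mod 8 + of_bool cy"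
    and "c = ((x mod 64 + of_bool cx) mod 64, (y mod 8 + of_bool cy) mod 8)"
  note defs = this
  let ?zs = "zip (digits 64 k (x div 64)) (digits 8 k (y div 8))"
  have 1: "step (machine a p) w (conf (TossRight u cx cy) i (int (length ls)) (ls @ (x mod 64, y mod 8) # ?zs)) =
      return_pmf (conf (TossRight u cx' cy') (move_input Stay i) (move_work Move_Right (int (length ls)))
        (ls @ c # ?zs))"
    unfolding defs by (rule step_cell) auto
  have "goes (Suc k) (conf (TossRight u cx cy) i (int (length ls)) (ls @ (x mod 64, y mod 8) # ?zs))
     (conf (TossRight u (carry 64 k (x div 64) cx') (carry 8 k (y div 8) cy')) i (int (length ls + Suc k))
      (ls @ c # zip (digits 64 k (x div 64 + of_bool cx')) (digits 8 k (y div 8 + of_bool cy'))))"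
    using Suc.IH[of "ls @ [c]" cx' cy' "x div 64" "y div 8"] Suc.prems
    by (intro reaches_step[OF _ 1]) (simp_all add: add.commute)
  then show ?case
    by (simp only: add_of_bool_div mod_add_left_eq digits.simps(2) carry.simps zip_Cons_Cons defs zero_less_numeral)
qed

section \<open>Counting modulo i\<close>

text \<open>The start of a right sweep at input position \<open>j\<close>, with trial divisor
  \<open>i\<close> and residue \<open>r\<close>; the incoming carry advances the residue everywhere,
  the divisor only at end-markers.\<close>

definition counting :: "move \<Rightarrow> nat \<Rightarrow> nat \<Rightarrow> nat \<Rightarrow> nat \<Rightarrow> (nat, nat) config" where
  "counting d j k i r = conf (CountRight d (is_end (input_at w j)) True True) j 0
     (zip (digits 64 k i) (digits 64 k r))"

lemma counting_right:
  assumes "k \<le> K"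
  shows "goes k (counting d j k i r)
    (conf (CountRight d (carry 64 k i (is_end (input_at w j))) (carry 64 k r True)
        (digits 64 k (Suc r) = digits 64 k i)) j (int k)
      (zip (digits 64 k (i + of_bool (is_end (input_at w j)))) (digits 64 k (Suc r))))"
  using count_right[of "[]" k d "is_end (input_at w j)" True True j i r] assms
  by (simp add: counting_def)

text \<open>The cost is two sweeps of \<open>k\<close> cells, a step on the blank at each end and
  one for \<open>Restart\<close>. By the first assumption the test at an end-marker succeeds, so the
  search goes on.\<close>

lemma counting_step:
  assumes "is_end (input_at w j) \<Longrightarrow> digits 64 k (Suc r) = digits 64 k i"
    and "i < 64 ^ k"
    and "k' = (if is_end (input_at w j) \<and> Suc i = 64 ^ k then Suc k else k)" "k' \<le> K"
    and "d' = turn (input_at w j) d"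
  shows "goes (2 * k + 3) (counting d j k i r)
    (counting d' (move_input d' j) k' (i + of_bool (is_end (input_at w j)))
      (if digits 64 k (Suc r) = digits 64 k i then 0 else Suc r))"
proof -
  define e eq where "e = is_end (input_at w j)" and "eq \<longleftrightarrow> digits 64 k (Suc r) = digits 64 k i"
  define x r' where "x = i + of_bool e" and "r' = (if eq then 0 else Suc r)"
  \<comment> \<open>The divisor outgrows its cells exactly at \<open>64 ^ k\<close>, so its new
    leading digit is 1; the residue is reset in the same step, so its digit is 0.\<close>
  define ds rs where "ds = zip (digits 64 k x) (digits 64 k (Suc r))"
    and "rs = (if e \<and> Suc i = 64 ^ k then [(1 :: nat, 0 :: nat)] else [])"
  define c cy where "c = carry 64 k i e" and "cy = carry 64 k r True"
  have c: "c \<longleftrightarrow> e \<and> Suc i = 64 ^ k"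
    using assms(2) by (simp add: carry_iff c_def)
  have e_eq: "e \<Longrightarrow> eq" using assms(1) by (simp add: e_def eq_def)
  have k': "k' = (if c then Suc k else k)" using assms(3) c by (simp add: e_def)
  have rs: "rs = (if c then [(1, 0)] else [])" by (simp add: rs_def c)
  have len: "length ds = k" by (simp add: ds_def)
  have k: "k \<le> K" "length ds + length rs \<le> K"
    using assms(4) k' len rs by (auto split: if_splits)
  have 0: "goes k (counting d j k i r) (conf (CountRight d c cy eq) j (int k) ds)"
    unfolding ds_def c_def cy_def eq_def x_def e_def by (rule counting_right[OF k(1)])
  have 1: "step (machine a p) w (conf (CountRight d c cy eq) j (int k) ds)
      = return_pmf (conf (CountLeft d eq) j (int k - 1) (ds @ rs))"
  proof (cases c)
    case True
    with step_extend[of p "CountRight d c cy eq" w j "CountLeft d eq" "(1, 0)" Stay Move_Left "int k" ds a]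
    show ?thesis using e_eq c rs len by (simp add: e_def)
  next
    case False
    with step_blank[of p "CountRight d c cy eq" w j "CountLeft d eq" Stay Move_Left "int k" ds a]
    show ?thesis using e_eq rs len by (auto simp: e_def)
  qed
  have 2: "goes k (conf (CountLeft d eq) j (int k - 1) (ds @ rs))
      (conf (CountLeft d eq) j (-1) (map (\<lambda>(x, y). (x, if eq then 0 else y)) ds @ rs))"
    using sweep_left[OF k(2), of "CountLeft d eq" j "\<lambda>(x, y). (x, if eq then 0 else y)"] len
    by auto
  define ws where "ws = zip (digits 64 k' x) (digits 64 k' r')"
  have word: "map (\<lambda>(x, y). (x, if eq then 0 else y)) ds @ rs = ws"
  proof (cases eq)
    case True
    then have map: "map (\<lambda>(x, y). (x, if eq then 0 else y)) ds = zip (digits 64 k x) (digits 64 k 0)"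
      by (simp add: ds_def map_zip_first)
    show ?thesis
    proof (cases c)
      case c': True
      then have "x = 64 ^ k" "k' = Suc k" "r' = 0" using c k' True by (auto simp: x_def r'_def)
      then have "ws = zip (digits 64 k x @ [1]) (digits 64 k 0 @ [0])"
        unfolding ws_def by (simp only: digits_snoc) simp
      with c' show ?thesis unfolding map rs by simp
    next
      case False
      then show ?thesis unfolding map rs using k' True by (simp add: ws_def r'_def)
    qed
  next
    case False
    then have "(\<lambda>(x, y). (x, if eq then 0 else y)) = (id :: cell \<Rightarrow> cell)" by auto
    with False e_eq c k' rs show ?thesis by (auto simp: ws_def r'_def ds_def)
  qed
  have 3: "step (machine a p) w (conf (CountLeft d eq) j (-1) ws) = return_pmf (conf (Restart d') (move_input d' j) (-1) ws)"
    using step_blank[of p "CountLeft d eq" w j "Restart d'" d' Stay "-1" ws a] assms(5) by simp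
  have 4: "step (machine a p) w (conf (Restart d') (move_input d' j) (-1) ws) = return_pmf (counting d' (move_input d' j) k' x r')"
    using step_blank[of p "Restart d'" w "move_input d' j" _ Stay Move_Right "-1" ws a]
    by (simp add: counting_def ws_def)
  have "goes 0 (counting d' (move_input d' j) k' x r') (counting d' (move_input d' j) k' x r')"
    by (rule evolves_refl) (simp add: counting_def)
  from reaches_step[OF _ 4 this]
  have "goes (Suc 0) (conf (Restart d') (move_input d' j) (-1) ws) (counting d' (move_input d' j) k' x r')"
    by simp
  from reaches_step[OF _ 3 this]
  have "goes (Suc (Suc 0)) (conf (CountLeft d eq) j (-1) ws) (counting d' (move_input d' j) k' x r')"
    by simp
  from reaches_step[OF _ 1 reaches_evolves[OF 2[unfolded word] this]]
  have "goes (Suc (k + Suc (Suc 0))) (conf (CountRight d c cy eq) j (int k) ds)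
      (counting d' (move_input d' j) k' x r')"
    using k by simp
  moreover have "k + Suc (k + Suc (Suc 0)) = 2 * k + 3" by simp
  ultimately have "goes (2 * k + 3) (counting d j k i r) (counting d' (move_input d' j) k' x r')"
    using reaches_evolves[OF 0] by metis
  then show ?thesis unfolding x_def r'_def eq_def e_def .
qed

text \<open>In the search, a failed test at an end-marker reveals a non-divisor. The divisor is
  still advanced, and a cell gained thereby is written as \<open>(0, 0)\<close> to suit the cleared
  counters.\<close>

lemma counting_exit:
  assumes "is_end (input_at w j)" "digits 64 k (Suc r) \<noteq> digits 64 k i" "i < 64 ^ k"
    and "k' = (if Suc i = 64 ^ k then Suc k else k)" "k' \<le> K"
  shows "goes (2 * k + 2) (counting d j k i r)
    (conf (Toss 0) j (-1) (zip (digits 64 k' 0) (digits 8 k' 0)))"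
proof -
  define ds rs where "ds = zip (digits 64 k (Suc i)) (digits 64 k (Suc r))"
    and "rs = (if Suc i = 64 ^ k then [(0 :: nat, 0 :: nat)] else [])"
  define c cy where "c = carry 64 k i True" and "cy = carry 64 k r True"
  have c: "c \<longleftrightarrow> Suc i = 64 ^ k"
    using assms(3) by (simp add: carry_iff c_def)
  have k': "k' = (if c then Suc k else k)" using assms(4) c by simp
  have rs: "rs = (if c then [(0, 0)] else [])" by (simp add: rs_def c)
  have len: "length ds = k" by (simp add: ds_def)
  have k: "k \<le> K" "length ds + length rs \<le> K"
    using assms(5) k' len rs by (auto split: if_splits)
  have 0: "goes k (counting d j k i r) (conf (CountRight d c cy False) j (int k) ds)"
    using counting_right[OF k(1), of d j i r] assms(1,2) by (simp add: ds_def c_def cy_def)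
  have 1: "step (machine a p) w (conf (CountRight d c cy False) j (int k) ds)
      = return_pmf (conf (TossLeft True 0) j (int k - 1) (ds @ rs))"
  proof (cases c)
    case True
    with step_extend[of p "CountRight d c cy False" w j "TossLeft True 0" "(0, 0)" Stay Move_Left "int k" ds a]
    show ?thesis using assms(1) rs len by simp
  next
    case False
    with step_blank[of p "CountRight d c cy False" w j "TossLeft True 0" Stay Move_Left "int k" ds a]
    show ?thesis using assms(1) rs len by simp
  qed
  have 2: "goes k (conf (TossLeft True 0) j (int k - 1) (ds @ rs))
      (conf (TossLeft True 0) j (-1) (map (\<lambda>_. (0, 0)) ds @ rs))"
    using sweep_left[OF k(2), of "TossLeft True 0" j "\<lambda>_. (0, 0)"] len by simp
  define ws where "ws = zip (digits 64 k' 0) (digits 8 k' 0)"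
  have word: "map (\<lambda>_. (0, 0)) ds @ rs = ws"
    by (cases c) (simp_all add: ws_def k' rs len map_replicate_const replicate_append_same)
  have 3: "step (machine a p) w (conf (TossLeft True 0) j (-1) ws) = return_pmf (conf (Toss 0) j (-1) ws)"
    using step_blank[of p "TossLeft True 0" w j "Toss 0" Stay Stay "-1" ws a] by simp
  have "goes 1 (conf (TossLeft True 0) j (-1) ws) (conf (Toss 0) j (-1) ws)"
    by (rule evolves_1) (use 3 in auto)
  from reaches_step[OF _ 1 reaches_evolves[OF 2[unfolded word] this]]
  have "goes (Suc (k + 1)) (conf (CountRight d c cy False) j (int k) ds) (conf (Toss 0) j (-1) ws)"
    using k by simp
  moreover have "k + Suc (k + 1) = 2 * k + 2" by simp
  ultimately have "goes (2 * k + 2) (counting d j k i r) (conf (Toss 0) j (-1) ws)"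
    using reaches_evolves[OF 0] by metis
  then show ?thesis unfolding ws_def .
qed

text \<open>The head position after \<open>j\<close> letters of a trip in direction
  \<open>d\<close>: \<open>j = 0\<close> is the first letter met, \<open>j = length w\<close> the
  opposite end-marker.\<close>

definition count_pos :: "move \<Rightarrow> nat \<Rightarrow> nat" where
  "count_pos d j = (if d = Move_Right then Suc j else length w - j)"

lemma counting_word:
  assumes "d = Move_Right \<or> d = Move_Left" "0 < i" "i < 64 ^ k" "k \<le> K" "m \<le> length w"
  shows "goes (m * (2 * k + 3)) (counting d (count_pos d 0) k i 0) (counting d (count_pos d m) k i (m mod i))"
  using assms(5)
proof (induction m)
  case 0
  then show ?case by (simp add: evolves_refl counting_def)
next
  case (Suc m)
  let ?s = "input_at w (count_pos d m)"
  have s: "?s = Letter (w ! (count_pos d m - 1))"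
    using Suc.prems by (auto simp: input_at_def count_pos_def)
  then have e: "\<not> is_end ?s" "turn ?s d = d" by (auto simp: is_end_def)
  have next_pos: "move_input d (count_pos d m) = count_pos d (Suc m)"
    using assms(1) by (auto simp: count_pos_def)
  have "goes (2 * k + 3) (counting d (count_pos d m) k i (m mod i))
      (counting d (count_pos d (Suc m)) k i (Suc m mod i))"
    using counting_step[of "count_pos d m" k "m mod i" i k d d] assms(3,4) e next_pos
    by (simp add: digits_Suc_mod_eq[OF assms(2,3)] mod_Suc)
  from reaches_evolves[OF Suc.IH this] Suc.prems show ?case
    by (simp add: add.commute)
qed

text \<open>The step at the end-marker completes the previous count to \<open>length w + 1\<close>
  and tests \<open>i\<close>; the letters then count for \<open>Suc i\<close>.\<close>

lemma counting_round_trip: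
  assumes "j = 0 \<or> j = Suc (length w)" "i = 0 \<or> i dvd Suc (length w)" "num_digits (Suc i) \<le> K"
  shows "\<exists>t d' j'. t \<le> Suc (length w) * (2 * K + 3) \<and> (j' = 0 \<or> j' = Suc (length w)) \<and>
    goes t (counting d j (num_digits i) i (length w mod i))
      (counting d' j' (num_digits (Suc i)) (Suc i) (length w mod Suc i))"
proof -
  let ?s = "input_at w j"
  let ?k = "num_digits i" and ?k' = "num_digits (Suc i)"
  define d' where "d' = turn ?s d"
  have s: "?s = (if j = 0 then Left_End else Right_End)"
    using assms(1) by (auto simp: input_at_def)
  then have e: "is_end ?s" and d': "d' = Move_Right \<or> d' = Move_Left" "move_input d' j = count_pos d' 0"
    using assms(1) by (auto simp: is_end_def d'_def count_pos_def)
  have eq: "digits 64 ?k (Suc (length w mod i)) = digits 64 ?k i"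
  \<comment> \<open>For \<open>i = 0\<close> both digit lists are empty; otherwise the residue
    reaches \<open>i\<close> because \<open>i\<close> divides \<open>length w + 1\<close>.\<close>
  proof (cases "i = 0")
    case False
    with assms(2) show ?thesis
      by (subst digits_Suc_mod_eq) (auto simp: less_num_digits mod_Suc dvd_eq_mod_eq_0 split: if_splits)
  qed simp
  have "goes (2 * ?k + 3) (counting d j ?k i (length w mod i)) (counting d' (count_pos d' 0) ?k' (Suc i) 0)"
    using counting_step[of j ?k "length w mod i" i ?k' d' d] eq e assms(3) less_num_digits[of i] d'
    by (simp add: d'_def)
  moreover have "goes (length w * (2 * ?k' + 3)) (counting d' (count_pos d' 0) ?k' (Suc i) 0)
      (counting d' (count_pos d' (length w)) ?k' (Suc i) (length w mod Suc i))"
    using d'(1) less_num_digits[of "Suc i"] assms(3) by (intro counting_word) auto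
  ultimately have "goes (2 * ?k + 3 + length w * (2 * ?k' + 3)) (counting d j ?k i (length w mod i))
      (counting d' (count_pos d' (length w)) ?k' (Suc i) (length w mod Suc i))"
    by (rule reaches_evolves)
  moreover have "?k \<le> K" using num_digits_mono[of i "Suc i"] assms(3) by linarith
  then have "2 * ?k + 3 + length w * (2 * ?k' + 3) \<le> (2 * K + 3) + length w * (2 * K + 3)"
    using assms(3) by (intro add_mono mult_le_mono) auto
  moreover have "count_pos d' (length w) = 0 \<or> count_pos d' (length w) = Suc (length w)"
    by (simp add: count_pos_def)
  ultimately show ?thesis by (metis mult_Suc)
qed

lemma counting_trips:
  assumes "\<And>i'. 0 < i' \<Longrightarrow> i' < i \<Longrightarrow> i' dvd Suc (length w)" "num_digits i \<le> K"
  shows "\<exists>t d j. t \<le> i * (Suc (length w) * (2 * K + 3)) \<and> (j = 0 \<or> j = Suc (length w)) \<and>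
    goes t (initial_config (machine a p)) (counting d j (num_digits i) i (length w mod i))"
  using assms
proof (induction i)
  case 0
  \<comment> \<open>\<open>length w mod 0\<close> is \<open>length w\<close>, but with no digits it
    leaves no trace on the tape.\<close>
  have "initial_config (machine a p) = counting Move_Right 0 (num_digits 0) 0 (length w mod 0)"
    by (simp add: initial_config_machine counting_def is_end_def input_at_def)
  then have "goes 0 (initial_config (machine a p)) (counting Move_Right 0 (num_digits 0) 0 (length w mod 0))"
    using evolves_refl[of "\<lambda>c. work_pos c \<in> {-1..int K}" "counting Move_Right 0 (num_digits 0) 0 (length w mod 0)"]
    by (simp add: counting_def)
  then show ?case by blast
next
  case (Suc i)
  have "num_digits i \<le> K" using num_digits_mono[of i "Suc i"] Suc.prems(2) by linarith
  then obtain t d j where 1: "t \<le> i * (Suc (length w) * (2 * K + 3))" "j = 0 \<or> j = Suc (length w)"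
    "goes t (initial_config (machine a p)) (counting d j (num_digits i) i (length w mod i))"
    using Suc.IH Suc.prems(1) by (metis less_SucI)
  have "i = 0 \<or> i dvd Suc (length w)" using Suc.prems(1)[of i] by auto
  from counting_round_trip[OF 1(2) this Suc.prems(2), of d] obtain t' d' j' where
    2: "t' \<le> Suc (length w) * (2 * K + 3)" "j' = 0 \<or> j' = Suc (length w)"
    "goes t' (counting d j (num_digits i) i (length w mod i))
      (counting d' j' (num_digits (Suc i)) (Suc i) (length w mod Suc i))" by blast
  have "t + t' \<le> Suc i * (Suc (length w) * (2 * K + 3))" using 1(1) 2(1) by simp
  with reaches_evolves[OF 1(3) 2(3)] 2(2) show ?case by blast
qed

section \<open>Tossing the coin\<close>

text \<open>The tape holds \<open>h\<close> modulo \<open>8 ^ K\<close> and the state the next octal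
  digit, which decides acceptance.\<close>

definition tossing :: "nat \<Rightarrow> nat \<Rightarrow> nat \<Rightarrow> (nat, nat) config" where
  "tossing j m h = conf (Toss (h div 8 ^ K mod 8)) j (-1) (zip (digits 64 K m) (digits 8 K h))"

lemma reaches_tossing:
  assumes "K = level (length w)"
  shows "\<exists>t j. t \<le> (length w + 3) * (Suc (length w) * (2 * K + 3)) \<and>
    goes t (initial_config (machine a p)) (tossing j 0 0)"
proof -
  define F where "F = least_nondivisor (Suc (length w))"
  note F = least_nondivisor[of "Suc (length w)", folded F_def]
  have K: "K = num_digits (Suc F)" by (simp add: assms level_def F_def)
  have "num_digits F \<le> K" using num_digits_mono[of F "Suc F"] K by linarith
  with counting_trips[of F] F(3) obtain t d j where
    1: "t \<le> F * (Suc (length w) * (2 * K + 3))" "j = 0 \<or> j = Suc (length w)"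
    "goes t (initial_config (machine a p)) (counting d j (num_digits F) F (length w mod F))"
    by auto
  have j: "is_end (input_at w j)" using 1(2) by (auto simp: is_end_def input_at_def)
  have neq: "digits 64 (num_digits F) (Suc (length w mod F)) \<noteq> digits 64 (num_digits F) F"
    using F(1,2) by (subst digits_Suc_mod_eq) (auto simp: less_num_digits mod_Suc dvd_eq_mod_eq_0)
  have "K = (if Suc F = 64 ^ num_digits F then Suc (num_digits F) else num_digits F)"
    using K by simp
  from counting_exit[OF j neq less_num_digits this order_refl, of d]
  have "goes (2 * num_digits F + 2) (counting d j (num_digits F) F (length w mod F)) (tossing j 0 0)"
    by (simp add: tossing_def)
  from reaches_evolves[OF 1(3) this]
  have "goes (t + (2 * num_digits F + 2)) (initial_config (machine a p)) (tossing j 0 0)" .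
  \<comment> \<open>There are \<open>F\<close> trips with \<open>F \<le> length w + 2\<close>, and
    the exit costs no more than one further trip.\<close>
  moreover have "t + (2 * num_digits F + 2) \<le> (length w + 3) * (Suc (length w) * (2 * K + 3))"
  proof -
    have "t + (2 * num_digits F + 2) \<le> Suc F * (Suc (length w) * (2 * K + 3))"
      using 1(1) \<open>num_digits F \<le> K\<close> by simp
    also have "\<dots> \<le> (length w + 3) * (Suc (length w) * (2 * K + 3))"
      using F(4) by (intro mult_le_mono1) simp
    finally show ?thesis .
  qed
  ultimately show ?thesis by (intro exI conjI)
qed

text \<open>Stopping before the rewinding sweep covers also the last toss, which halts instead; the
  carry out of the base-64 counter signals it.\<close>

lemma toss_half:
  assumes "m < 64 ^ K"
  defines "halt \<equiv> (\<lambda>h. if 4 \<le> h div 8 ^ K mod 8 then Accepted else Rejected)"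
  shows "evo (K + 2) (tossing j m h) (map_pmf (\<lambda>b. conf
      (if Suc m = 64 ^ K then halt (h + of_bool b) else TossLeft False ((h + of_bool b) div 8 ^ K mod 8))
      j (int K - 1) (zip (digits 64 K (Suc m)) (digits 8 K (h + of_bool b)))) (bernoulli_pmf p))"
proof -
  let ?u = "h div 8 ^ K mod 8"
  let ?ws = "zip (digits 64 K m) (digits 8 K h)"
  let ?end = "\<lambda>b. conf
      (if Suc m = 64 ^ K then halt (h + of_bool b) else TossLeft False ((h + of_bool b) div 8 ^ K mod 8))
      j (int K - 1) (zip (digits 64 K (Suc m)) (digits 8 K (h + of_bool b)))"
  have toss: "evo 1 (tossing j m h) (map_pmf (\<lambda>b. conf (TossRight ?u True b) j 0 ?ws) (bernoulli_pmf p))"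
    unfolding tossing_def by (rule evolves_1[OF _ step_toss]) auto
  have "goes (K + 1) (conf (TossRight ?u True b) j 0 ?ws) (?end b)" for b
  proof -
    define cy where "cy = carry 8 K h b"
    define ws where "ws = zip (digits 64 K (Suc m)) (digits 8 K (h + of_bool b))"
    have u: "(?u + of_bool cy) mod 8 = (h + of_bool b) div 8 ^ K mod 8"
      by (simp add: carry_div cy_def mod_add_left_eq)
    have right: "goes K (conf (TossRight ?u True b) j 0 ?ws) (conf (TossRight ?u (Suc m = 64 ^ K) cy) j (int K) ws)"
      using toss_right[of "[]" K ?u True b j m h] assms(1) by (simp add: ws_def cy_def carry_iff)
    have "step (machine a p) w (conf (TossRight ?u (Suc m = 64 ^ K) cy) j (int K) ws) = return_pmf (?end b)"
      using step_blank[of p "TossRight ?u (Suc m = 64 ^ K) cy" w j _ Stay Move_Left "int K" ws a]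
      by (simp add: u halt_def Let_def ws_def)
    from reaches_evolves[OF right evolves_1[OF _ this]] show ?thesis by simp
  qed
  from evolves_bind[OF toss this] show ?thesis by (simp add: map_pmf_def)
qed

lemma toss_round:
  assumes "Suc m < 64 ^ K"
  shows "evo (2 * K + 3) (tossing j m h) (map_pmf (\<lambda>b. tossing j (Suc m) (h + of_bool b)) (bernoulli_pmf p))"
proof -
  have left: "goes (K + 1) (conf (TossLeft False ((h + of_bool b) div 8 ^ K mod 8)) j (int K - 1)
      (zip (digits 64 K (Suc m)) (digits 8 K (h + of_bool b)))) (tossing j (Suc m) (h + of_bool b))" for b
  proof -
    define u ws where "u = (h + of_bool b) div 8 ^ K mod 8"
      and "ws = zip (digits 64 K (Suc m)) (digits 8 K (h + of_bool b))"
    have "goes K (conf (TossLeft False u) j (int K - 1) ws) (conf (TossLeft False u) j (-1) ws)"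
      using sweep_left[of ws "[]" "TossLeft False u" j id] by (simp add: ws_def)
    moreover have "step (machine a p) w (conf (TossLeft False u) j (-1) ws) = return_pmf (tossing j (Suc m) (h + of_bool b))"
      using step_blank[of p "TossLeft False u" w j "Toss u" Stay Stay "-1" ws a]
      by (simp add: tossing_def u_def ws_def)
    then have "goes 1 (conf (TossLeft False u) j (-1) ws) (tossing j (Suc m) (h + of_bool b))"
      by (intro evolves_1) (auto simp: tossing_def)
    ultimately show ?thesis unfolding u_def ws_def by (rule reaches_evolves)
  qed
  have half: "evo (K + 2) (tossing j m h) (map_pmf (\<lambda>b. conf
      (TossLeft False ((h + of_bool b) div 8 ^ K mod 8)) j (int K - 1)
      (zip (digits 64 K (Suc m)) (digits 8 K (h + of_bool b)))) (bernoulli_pmf p))"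
    using toss_half[of m j h] assms by simp
  have "K + 2 + (K + 1) = 2 * K + 3" by simp
  with evolves_bind[OF half left] show ?thesis
    unfolding map_pmf_def by metis
qed

lemma toss_rounds:
  assumes "p \<in> {0..1}" "m < 64 ^ K"
  shows "evo (m * (2 * K + 3)) (tossing j 0 0) (map_pmf (tossing j m) (binomial_pmf m p))"
  using assms(2)
proof (induction m)
  case 0
  then show ?case
    by (simp add: binomial_pmf_0[OF assms(1)] evolves_refl tossing_def)
next
  case (Suc m)
  have "evo (m * (2 * K + 3) + (2 * K + 3)) (tossing j 0 0) (map_pmf (tossing j (Suc m)) (binomial_pmf (Suc m) p))"
    unfolding bind_binomial_bernoulli[OF assms(1), symmetric]
    using Suc by (intro evolves_bind[OF Suc.IH toss_round]) auto
  then show ?case by (simp add: add.commute)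
qed

lemma toss_all:
  assumes "p \<in> {0..1}"
  shows "\<exists>t \<le> 64 ^ K * (2 * K + 3). evo t (tossing j 0 0)
    (map_pmf (\<lambda>h. conf (if 4 \<le> h div 8 ^ K mod 8 then Accepted else Rejected) j (int K - 1)
      (zip (digits 64 K (64 ^ K)) (digits 8 K h))) (binomial_pmf (64 ^ K) p))"
proof -
  define m where "m = (64 ^ K - 1 :: nat)"
  have m: "m < 64 ^ K" "64 ^ K = Suc m" by (simp_all add: m_def)
  define f where "f = (\<lambda>h. conf (if 4 \<le> h div 8 ^ K mod 8 then Accepted else Rejected) j (int K - 1)
      (zip (digits 64 K (Suc m)) (digits 8 K h)))"
  have "evo (K + 2) (tossing j m h) (map_pmf (\<lambda>b. f (h + of_bool b)) (bernoulli_pmf p))" for h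
    using toss_half[OF m(1), of j h] m(2) by (simp add: f_def)
  from evolves_bind[OF toss_rounds[OF assms m(1)] this]
  have "evo (m * (2 * K + 3) + (K + 2)) (tossing j 0 0) (map_pmf f (binomial_pmf (Suc m) p))"
    unfolding bind_binomial_bernoulli[OF assms, of m f] .
  moreover have "m * (2 * K + 3) + (K + 2) \<le> Suc m * (2 * K + 3)" by simp
  ultimately show ?thesis unfolding m(2) f_def by (intro exI conjI)
qed

end

section \<open>Time, space and acceptance probability of the machine\<close>

text \<open>At most \<open>(n + 3) * Suc n\<close> counting steps and \<open>64 * (n + 3)\<close>
  tosses, each costing at most \<open>2 * K + 3 \<le> 2 * n + 9\<close>.\<close>

definition time_bound :: "nat \<Rightarrow> nat" where
  "time_bound n = ((n + 3) * Suc n + 64 * (n + 3)) * (2 * n + 9)"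

text \<open>The search is deterministic, so \<open>D\<close> depends on the tosses alone; time,
  space and acceptance are all read off from this one run.\<close>

lemma machine_evolves:
  assumes "p \<in> {0..1}"
  obtains t D where "t \<le> time_bound (length w)"
    "evolves (machine a p) w (\<lambda>c. work_pos c \<in> {-1..int (level (length w))}) t (initial_config (machine a p)) D"
    "\<forall>c \<in> set_pmf D. halted (machine a p) c"
    "measure_pmf.prob D {c. cstate c = accepting (machine a p)} =
      measure_pmf.prob (binomial_pmf (64 ^ level (length w)) p) {h. 4 \<le> h div 8 ^ level (length w) mod 8}"
proof -
  define K where "K = level (length w)"
  interpret bounded_run a p w K .
  obtain t j where 1: "t \<le> (length w + 3) * (Suc (length w) * (2 * K + 3))"
    "goes t (initial_config (machine a p)) (tossing j 0 0)"
    using reaches_tossing K_def by blast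
  define f where "f = (\<lambda>h. conf (if 4 \<le> h div 8 ^ K mod 8 then Accepted else Rejected) j (int K - 1)
      (zip (digits 64 K (64 ^ K)) (digits 8 K h)))"
  obtain t' where 2: "t' \<le> 64 ^ K * (2 * K + 3)"
    "evo t' (tossing j 0 0) (map_pmf f (binomial_pmf (64 ^ K) p))"
    using toss_all[OF assms, of j] unfolding f_def by blast
  have "K \<le> length w + 3"
    using num_digits_le_self[of "Suc (least_nondivisor (Suc (length w)))"]
      least_nondivisor(4)[of "Suc (length w)"] by (simp add: K_def level_def)
  then have K: "2 * K + 3 \<le> 2 * length w + 9" by simp
  have "t + t' \<le> (length w + 3) * Suc (length w) * (2 * K + 3) + 64 ^ K * (2 * K + 3)"
    using add_mono[OF 1(1) 2(1)] by (simp only: mult.assoc)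
  also have "\<dots> = ((length w + 3) * Suc (length w) + 64 ^ K) * (2 * K + 3)"
    by (simp only: add_mult_distrib)
  also have "\<dots> \<le> time_bound (length w)"
    unfolding time_bound_def using level_power_le[of "length w"]
    by (intro mult_le_mono[OF _ K] add_mono order_refl) (simp add: K_def)
  finally have "t + t' \<le> time_bound (length w)" .
  moreover have "evo (t + t') (initial_config (machine a p)) (map_pmf f (binomial_pmf (64 ^ K) p))"
    by (rule reaches_evolves[OF 1(2) 2(2)])
  moreover have "\<forall>c \<in> set_pmf (map_pmf f (binomial_pmf (64 ^ K) p)). halted (machine a p) c"
    by (auto simp: f_def halted_conf)
  moreover have "measure_pmf.prob (map_pmf f (binomial_pmf (64 ^ K) p)) {c. cstate c = accepting (machine a p)} =
      measure_pmf.prob (binomial_pmf (64 ^ K) p) {h. 4 \<le> h div 8 ^ K mod 8}"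
    by (simp add: f_def conf_def vimage_def)
  ultimately show ?thesis using that K_def by simp
qed

lemma polynomial_time_machine:
  assumes "p \<in> {0..1}"
  shows "polynomial_time (machine a p)"
proof -
  have "(\<lambda>n. real (time_bound n)) \<in> O(\<lambda>n. real n ^ 3)"
    unfolding time_bound_def of_nat_mult of_nat_add of_nat_Suc by real_asymp
  moreover have "time_used (machine a p) w \<le> enat (time_bound (length w))" for w
  proof (rule machine_evolves[OF assms, of w a])
    fix t D
    assume "t \<le> time_bound (length w)"
      "evolves (machine a p) w (\<lambda>c. work_pos c \<in> {-1..int (level (length w))}) t (initial_config (machine a p)) D"
      "\<forall>c \<in> set_pmf D. halted (machine a p) c"
    then have "time_used (machine a p) w \<le> enat t"
      by (intro time_used_le) (simp add: evolves_def config_after_eq_run)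
    also have "\<dots> \<le> enat (time_bound (length w))" using \<open>t \<le> _\<close> by simp
    finally show ?thesis .
  qed
  ultimately show ?thesis unfolding polynomial_time_def by blast
qed

lemma space_machine:
  assumes "p \<in> {0..1}"
  shows "space_in_O (machine a p) (\<lambda>n. ln (ln (real n)))"
proof -
  have "space_used (machine a p) w \<le> enat (level (length w) + 2)" for w
  proof (rule machine_evolves[OF assms, of w a])
    fix t D
    assume "evolves (machine a p) w (\<lambda>c. work_pos c \<in> {-1..int (level (length w))}) t (initial_config (machine a p)) D"
      "\<forall>c \<in> set_pmf D. halted (machine a p) c"
    from space_used_le[OF this] show ?thesis by (simp add: nat_add_distrib)
  qed
  with level_bigo show ?thesis
    unfolding space_in_O_def by (intro exI[of _ "\<lambda>n. level n + 2"]) simp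
qed

text \<open>\<open>coin_bias\<close> numbers digits from 0 and scales by \<open>8 ^ Suc k\<close>,
  so level \<open>Suc k\<close> reads digit \<open>k\<close>; levels are positive.\<close>

lemma recognizes_machine:
  fixes A :: "nat set"
  obtains p :: real where "p \<in> {0..1}"
    "recognizes_bounded_error (machine a p) {w \<in> lists {a}. level (length w) - 1 \<in> A}"
proof -
  obtain p :: real where p: "p \<in> {0..1}" and digit: "\<And>k. \<exists>z::nat.
      real (8 * z + (if k \<in> A then 5 else 1)) \<le> 8 ^ Suc k * p \<and>
      8 ^ Suc k * p \<le> real (8 * z + (if k \<in> A then 5 else 1) + 1)"
    using coin_bias[of A] by blast
  have "(level (length w) - 1 \<in> A \<longrightarrow> accept_prob (machine a p) w \<ge> 1 - 2/5) \<and>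
      (level (length w) - 1 \<notin> A \<longrightarrow> accept_prob (machine a p) w \<le> 2/5)" for w
  proof -
    let ?K = "level (length w)"
    have K: "Suc (?K - 1) = ?K" using level_pos[of "length w"] by simp
    have acc: "accept_prob (machine a p) w =
        measure_pmf.prob (binomial_pmf (64 ^ ?K) p) {h. 4 \<le> h div 8 ^ ?K mod 8}"
    proof (rule machine_evolves[OF p, of w a])
      fix t D
      assume "evolves (machine a p) w (\<lambda>c. work_pos c \<in> {-1..int ?K}) t (initial_config (machine a p)) D"
        and D: "\<forall>c \<in> set_pmf D. halted (machine a p) c"
        "measure_pmf.prob D {c. cstate c = accepting (machine a p)} =
          measure_pmf.prob (binomial_pmf (64 ^ ?K) p) {h. 4 \<le> h div 8 ^ ?K mod 8}"
      then have "config_after (machine a p) w t = D" by (simp add: evolves_def config_after_eq_run)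
      with accept_prob_eq[of "machine a p" w t] D show ?thesis by simp
    qed
    obtain z :: nat where z: "real (8 * z + (if ?K - 1 \<in> A then 5 else 1)) \<le> 8 ^ ?K * p"
      "8 ^ ?K * p \<le> real (8 * z + (if ?K - 1 \<in> A then 5 else 1) + 1)"
      using digit[of "?K - 1"] unfolding K by blast
    show ?thesis
      using binomial_octal_digit[OF p z] unfolding acc by (cases "?K - 1 \<in> A") simp_all
  qed
  then have "recognizes_bounded_error (machine a p) {w \<in> lists {a}. level (length w) - 1 \<in> A}"
    unfolding recognizes_bounded_error_def by (intro conjI exI[of _ "2/5"]) auto
  with p that show ?thesis by blast
qed

section \<open>Uncountably many languages\<close>

text \<open>Cantor's diagonal argument, carried out on a copy of \<open>nat\<close> inside
  \<open>S\<close>.\<close>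

lemma uncountable_Pow:
  assumes "infinite S"
  shows "uncountable (Pow S)"
proof
  assume "countable (Pow S)"
  then obtain f :: "nat \<Rightarrow> 'a set" where f: "range f = Pow S"
    using range_from_nat_into[of "Pow S"] by blast
  obtain g :: "nat \<Rightarrow> 'a" where g: "inj g" "range g \<subseteq> S"
    using infinite_countable_subset[OF assms] by blast
  have "{g n |n. g n \<notin> f n} \<in> Pow S" using g(2) by auto
  then obtain m where m: "{g n |n. g n \<notin> f n} = f m"
    using f by (metis (no_types, lifting) rangeE)
  have "g m \<in> {g n |n. g n \<notin> f n} \<longleftrightarrow> g m \<notin> f m"
    using injD[OF g(1)] by blast
  with m show False by simp
qed

theorem theorem1:
  fixes a :: 'a
  shows "uncountable {L :: 'a list set. \<exists>M :: (nat, nat, 'a) ptm.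
           is_ptm M \<and> input_alphabet M = {a} \<and> polynomial_time M \<and>
           space_in_O M (\<lambda>n. ln (ln (real n))) \<and> recognizes_bounded_error M L}"
    (is "uncountable ?\<L>")
proof
  let ?level = "\<lambda>n. level n - 1"
  assume "countable ?\<L>"
  then have "countable ((\<lambda>L. (\<lambda>w. ?level (length w)) ` L) ` ?\<L>)" by (rule countable_image)
  \<comment> \<open>Each set of attained values of \<open>?level\<close> is recovered from its
    language as the values on the words, so countably many languages would leave only countably many
    such sets.\<close>
  moreover have "Pow (range ?level) \<subseteq> (\<lambda>L. (\<lambda>w. ?level (length w)) ` L) ` ?\<L>"
  proof
    fix A assume A: "A \<in> Pow (range ?level)"
    obtain p where "p \<in> {0..1}"
      "recognizes_bounded_error (machine a p) {w \<in> lists {a}. ?level (length w) \<in> A}"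
      by (rule recognizes_machine)
    then have "{w \<in> lists {a}. ?level (length w) \<in> A} \<in> ?\<L>"
      using is_ptm_machine[of a p] polynomial_time_machine[of p a] space_machine[of p a] by auto
    moreover have "A = (\<lambda>w. ?level (length w)) ` {w \<in> lists {a}. ?level (length w) \<in> A}"
    proof (intro equalityI subsetI)
      fix x assume "x \<in> A"
      with A obtain n where "x = ?level n" by auto
      with \<open>x \<in> A\<close> show "x \<in> (\<lambda>w. ?level (length w)) ` {w \<in> lists {a}. ?level (length w) \<in> A}"
        by (intro image_eqI[of _ _ "replicate n a"]) auto
    qed auto
    ultimately show "A \<in> (\<lambda>L. (\<lambda>w. ?level (length w)) ` L) ` ?\<L>" by (rule rev_image_eqI)
  qed
  ultimately have "countable (Pow (range ?level))" by (rule countable_subset[rotated])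
  moreover have "infinite (range ?level)"
  proof
    assume "finite (range ?level)"
    then have "finite (Suc ` range ?level)" by (rule finite_imageI)
    moreover have "Suc ` range ?level = range level"
      using level_pos by (force simp: image_iff)
    ultimately show False using infinite_range_level by simp
  qed
  ultimately show False using uncountable_Pow by blast
qed

end
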